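(* Let $m\ge1$ be an integer. Every $\mathbb R_{0,m}$-valued two-sided monogenic homogeneous polynomial in $\mathbb R^{m+1}$ can be written as a finite sum of axial two-sided monogenic polynomials of the form $$\mathsf{CK}\big[\alpha_{n,\ell}|\underline x|^{2n}P_{k,\ell}(\underline x)+|\underline x|^{2n-2}\,\underline xP_{k,\ell}(\underline x)\,\underline x\big]\ \ (n\ge1),\qquad P_{k,\ell}(\underline x),\qquad \mathsf{CK}\big[|\underline x|^{2n}\left(\underline xP_{k,\ell}(\underline x)+P_{k,\ell}(\underline x)\,\underline x\right)\big]\ \ (n\ge0),$$ where $k$ and $n$ denote non-negative integers, $P_{k,\ell}$ is an $\mathbb R_{0,m}^{(\ell)}$-valued polynomial belonging to $\mathsf{M}_{l}(k)$ $(0\le\ell\le m)$, and $$\alpha_{n,\ell}=-\frac{2k+2n+m-\mu_{\ell}}{2n},\qquad \mu_\ell=(-1)^\ell(2\ell-m).$$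
   Context: $\mathbb R_{0,m}$ is the real Clifford algebra generated by the canonical basis $e_1,\dots,e_m$ of $\mathbb R^m$ with $e_je_k+e_ke_j=-2\delta_{jk}$. For $A=\{j_1<\dots<j_s\}\subset\{1,\dots,m\}$ put $e_A=e_{j_1}\cdots e_{j_s}$, $e_\emptyset=1$, and $\mathbb R_{0,m}^{(\ell)}=\mathrm{span}_{\mathbb R}(e_A:|A|=\ell)$ ($\ell$-vectors). Points of $\mathbb R^m$ are identified with $\underline x=\sum_{j=1}^m x_je_j$, so $\underline x^2=-|\underline x|^2$; points of $\mathbb R^{m+1}$ are written $(x_0,\underline x)$. The Dirac operator is $\partial_{\underline x}=\sum_{j=1}^me_j\partial_{x_j}$, acting from the left by $\partial_{\underline x}f=\sum_je_j\,\partial_{x_j}f$ and from the right by $f\partial_{\underline x}=\sum_j(\partial_{x_j}f)\,e_j$. A continuously differentiable $\mathbb R_{0,m}$-valued function $f$ on an open subset of $\mathbb R^{m+1}$ is two-sided monogenic if $\partial_{x_0}f+\partial_{\underline x}f=0$ and $\partial_{x_0}f+f\partial_{\underline x}=0$. $\mathsf M_l(k)$ is the set of homogeneous polynomials $P$ of degree $k$ in $\mathbb R^m$ with $\partial_{\underline x}P=0$. For a polynomial $g(\underline x)$ on $\mathbb R^m$, its Cauchy-Kowalevski extension (the unique left monogenic extension, i.e. the unique extension $f$ to $\mathbb R^{m+1}$ with $\partial_{x_0}f+\partial_{\underline x}f=0$) is $\mathsf{CK}[g(\underline x)](x_0,\underline x)=\sum_{n=0}^\infty\frac{(-x_0)^n}{n!}\,\partial_{\underline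 x}^n g(\underline x)$ (a finite sum). A function is axial two-sided monogenic if it is two-sided monogenic and is of the form $A(x_0,r)P_{k,\ell}(\underline x)+B(x_0,r)\underline xP_{k,\ell}(\underline x)+C(x_0,r)P_{k,\ell}(\underline x)\underline x+D(x_0,r)\underline x P_{k,\ell}(\underline x)\underline x$, where $r=|\underline x|$, $P_{k,\ell}$ is an $\mathbb R_{0,m}^{(\ell)}$-valued polynomial in $\mathsf M_l(k)$ (here $0\le\ell\le m$), and $A,B,C,D$ are real-valued continuously differentiable functions in some open subset of $\{(x_1,x_2)\in\mathbb R^2:x_2>0\}$. *)

theory Defs
  imports "HOL-Analysis.Analysis"
begin

section \<open>The Clifford algebra with negative definite signature\<close>

text \<open>
  The finite linearly ordered type \<open>'m\<close> indexes the canonical basis of \<open>real ^ 'm\<close>, so that the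
  dimension is \<open>m = CARD('m)\<close>. An element is the family of its real coordinates with respect
  to the products \<open>e\<^sub>A\<close>, where \<open>A\<close> ranges over the subsets of \<open>'m\<close>.
\<close>

typedef 'm clifford = "UNIV :: ('m set \<Rightarrow> real) set"
  morphisms coords of_coords ..

lemma clifford_eq_iff: "x = y \<longleftrightarrow> (\<forall>A. coords x A = coords y A)"
  by (metis coords_inject ext)

lemma coords_of_coords [simp]: "coords (of_coords f) = f"
  by (simp add: of_coords_inverse)

text \<open>
  \<open>e\<^sub>A e\<^sub>B = blade_sign A B e\<^sub>C\<close> with \<open>C\<close> the symmetric difference of \<open>A\<close> and \<open>B\<close>: sorting the
  concatenated word costs a factor \<open>-1\<close> for each pair \<open>a \<in> A\<close>, \<open>b \<in> B\<close> with \<open>b < a\<close>, and each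
  common index contributes a square \<open>-1\<close>.
\<close>

definition blade_sign :: "'m::{finite,linorder} set \<Rightarrow> 'm set \<Rightarrow> real" where
  "blade_sign A B = (\<Prod>a\<in>A. \<Prod>b\<in>B. if b \<le> a then - 1 else 1)"

lemma prod_sym_diff:
  fixes h :: "'m::finite \<Rightarrow> real"
  assumes "\<And>x. h x * h x = 1"
  shows "prod h (sym_diff A B) = prod h A * prod h B"
proof -
  have "prod h A = prod h (A - B) * prod h (A \<inter> B)"
    by (subst prod.union_disjoint [symmetric]) (auto intro: prod.cong)
  moreover have "prod h B = prod h (B - A) * prod h (A \<inter> B)"
    by (subst prod.union_disjoint [symmetric]) (auto intro: prod.cong)
  moreover have "prod h (A \<inter> B) * prod h (A \<inter> B) = 1"
    by (simp add: prod.distrib [symmetric] assms)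
  moreover have "prod h (sym_diff A B) = prod h (A - B) * prod h (B - A)"
    by (rule prod.union_disjoint) auto
  ultimately show ?thesis
    by (simp add: algebra_simps)
qed

lemma blade_sign_square: "blade_sign A B * blade_sign A B = 1"
  by (auto simp: blade_sign_def prod.distrib [symmetric] intro!: prod.neutral)

lemma blade_sign_sym_diff_left:
  "blade_sign (sym_diff A B) C = blade_sign A C * blade_sign B C"
  unfolding blade_sign_def
  by (rule prod_sym_diff) (auto simp: prod.distrib [symmetric] intro!: prod.neutral)

lemma blade_sign_sym_diff_right:
  "blade_sign A (sym_diff B C) = blade_sign A B * blade_sign A C"
proof -
  have "(\<Prod>b\<in>sym_diff B C. if b \<le> a then - 1 else (1::real)) =
      (\<Prod>b\<in>B. if b \<le> a then - 1 else 1) * (\<Prod>b\<in>C. if b \<le> a then - 1 else 1)" for a :: 'a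
    by (rule prod_sym_diff) simp
  then show ?thesis
    by (simp add: blade_sign_def prod.distrib)
qed

lemma blade_sign_empty [simp]: "blade_sign {} A = 1" "blade_sign A {} = 1"
  by (simp_all add: blade_sign_def)

lemma sym_diff_sym_diff [simp]: "sym_diff A (sym_diff A B) = B"
  by auto

instantiation clifford :: ("{finite,linorder}") real_algebra_1
begin

definition zero_clifford :: "'a clifford" where
  "0 = of_coords (\<lambda>A. 0)"

definition one_clifford :: "'a clifford" where
  "1 = of_coords (\<lambda>A. if A = {} then 1 else 0)"

definition plus_clifford :: "'a clifford \<Rightarrow> 'a clifford \<Rightarrow> 'a clifford" where
  "x + y = of_coords (\<lambda>A. coords x A + coords y A)"

definition minus_clifford :: "'a clifford \<Rightarrow> 'a clifford \<Rightarrow> 'a clifford" where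
  "x - y = of_coords (\<lambda>A. coords x A - coords y A)"

definition uminus_clifford :: "'a clifford \<Rightarrow> 'a clifford" where
  "- x = of_coords (\<lambda>A. - coords x A)"

definition scaleR_clifford :: "real \<Rightarrow> 'a clifford \<Rightarrow> 'a clifford" where
  "r *\<^sub>R x = of_coords (\<lambda>A. r * coords x A)"

definition times_clifford :: "'a clifford \<Rightarrow> 'a clifford \<Rightarrow> 'a clifford" where
  "x * y = of_coords (\<lambda>C. \<Sum>A\<in>UNIV.
     blade_sign A (sym_diff A C) * coords x A * coords y (sym_diff A C))"

lemmas clifford_op_defs = zero_clifford_def one_clifford_def plus_clifford_def
  minus_clifford_def uminus_clifford_def scaleR_clifford_def times_clifford_def

instance
proof
  fix x y z :: "'a clifford" and r s :: real
  show "x * y * z = x * (y * z)"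
    unfolding clifford_eq_iff
  proof
    fix D :: "'a set"
    have sgn: "blade_sign A (sym_diff A D) * blade_sign B (sym_diff B A) =
        blade_sign B (sym_diff B D) * blade_sign (sym_diff B A) (sym_diff A D)" for A B :: "'a set"
    proof -
      have "sym_diff B D = sym_diff (sym_diff B A) (sym_diff A D)"
        by auto
      then have *: "blade_sign B (sym_diff B D) =
          blade_sign B (sym_diff B A) * blade_sign B (sym_diff A D)"
        by (simp only: blade_sign_sym_diff_right)
      have "blade_sign (sym_diff B A) (sym_diff A D) =
          blade_sign B (sym_diff A D) * blade_sign A (sym_diff A D)"
        by (rule blade_sign_sym_diff_left)
      then show ?thesis
        using blade_sign_square [of B "sym_diff A D"] * by (simp add: algebra_simps)
    qed
    have "coords (x * y * z) D = (\<Sum>A\<in>UNIV. \<Sum>B\<in>UNIV.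
        (blade_sign A (sym_diff A D) * blade_sign B (sym_diff B A)) *
        (coords x B * coords y (sym_diff B A) * coords z (sym_diff A D)))"
      by (simp only: times_clifford_def coords_of_coords sum_distrib_left sum_distrib_right mult_ac)
    also have "\<dots> = (\<Sum>B\<in>UNIV. \<Sum>A\<in>UNIV.
        (blade_sign B (sym_diff B D) * blade_sign (sym_diff B A) (sym_diff A D)) *
        (coords x B * coords y (sym_diff B A) * coords z (sym_diff A D)))"
      by (subst sum.swap) (simp only: sgn)
    also have "\<dots> = (\<Sum>B\<in>UNIV. \<Sum>E\<in>UNIV.
        (blade_sign B (sym_diff B D) * blade_sign E (sym_diff E (sym_diff B D))) *
        (coords x B * coords y E * coords z (sym_diff E (sym_diff B D))))"
    proof (rule sum.cong [OF refl])
      fix B :: "'a set"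
      have eq: "sym_diff A D = sym_diff (sym_diff B A) (sym_diff B D)" for A :: "'a set"
        by auto
      have bij: "bij (\<lambda>A. sym_diff B A)"
        by (rule o_bij [of "\<lambda>A. sym_diff B A"]) (simp_all add: fun_eq_iff)
      show "(\<Sum>A\<in>UNIV.
          (blade_sign B (sym_diff B D) * blade_sign (sym_diff B A) (sym_diff A D)) *
          (coords x B * coords y (sym_diff B A) * coords z (sym_diff A D))) =
        (\<Sum>E\<in>UNIV.
          (blade_sign B (sym_diff B D) * blade_sign E (sym_diff E (sym_diff B D))) *
          (coords x B * coords y E * coords z (sym_diff E (sym_diff B D))))"
        by (subst sum.reindex_bij_betw [OF bij, symmetric], simp only: eq [symmetric])
    qed
    also have "\<dots> = coords (x * (y * z)) D"
      by (simp only: times_clifford_def coords_of_coords sum_distrib_left sum_distrib_right mult_ac)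
    finally show "coords (x * y * z) D = coords (x * (y * z)) D" .
  qed
  show "1 * x = x"
    by (simp add: clifford_eq_iff clifford_op_defs mult_delta_left
        mult_delta_right)
  show "x * 1 = x"
    unfolding clifford_eq_iff
  proof
    fix C :: "'a set"
    have "sym_diff A C = {} \<longleftrightarrow> A = C" for A
      by auto
    then show "coords (x * 1) C = coords x C"
      by (simp add: clifford_op_defs mult_delta_left mult_delta_right)
  qed
  show "0 \<noteq> (1 :: 'a clifford)"
    by (auto simp: clifford_eq_iff clifford_op_defs)
  show "(x + y) * z = x * z + y * z" "x * (y + z) = x * y + x * z"
    by (simp_all add: clifford_eq_iff plus_clifford_def times_clifford_def
        distrib_left distrib_right sum.distrib)
  show "r *\<^sub>R x * y = r *\<^sub>R (x * y)" "x * r *\<^sub>R y = r *\<^sub>R (x * y)"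
    by (simp_all add: clifford_eq_iff scaleR_clifford_def times_clifford_def
        sum_distrib_left mult.left_commute mult.assoc)
qed (simp_all add: clifford_eq_iff plus_clifford_def minus_clifford_def uminus_clifford_def
    zero_clifford_def scaleR_clifford_def distrib_left distrib_right)

end

instantiation clifford :: ("{finite,linorder}") real_inner
begin

definition inner_clifford :: "'a clifford \<Rightarrow> 'a clifford \<Rightarrow> real" where
  "x \<bullet> y = (\<Sum>A\<in>UNIV. coords x A * coords y A)"

definition norm_clifford :: "'a clifford \<Rightarrow> real" where
  "norm (x :: 'a clifford) = sqrt (x \<bullet> x)"

definition dist_clifford :: "'a clifford \<Rightarrow> 'a clifford \<Rightarrow> real" where
  "dist (x :: 'a clifford) y = norm (x - y)"

definition sgn_clifford :: "'a clifford \<Rightarrow> 'a clifford" where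
  "sgn (x :: 'a clifford) = x /\<^sub>R norm x"

definition uniformity_clifford :: "('a clifford \<times> 'a clifford) filter" where
  "uniformity = (INF e\<in>{0 <..}. principal {(x :: 'a clifford, y). dist x y < e})"

definition open_clifford :: "'a clifford set \<Rightarrow> bool" where
  "open (U :: 'a clifford set) \<longleftrightarrow> (\<forall>x\<in>U. eventually (\<lambda>(x', y). x' = x \<longrightarrow> y \<in> U) uniformity)"

instance
proof
  fix x y z :: "'a clifford" and r :: real
  show "x \<bullet> y = y \<bullet> x"
    by (simp add: inner_clifford_def mult.commute)
  show "(x + y) \<bullet> z = x \<bullet> z + y \<bullet> z"
    by (simp add: inner_clifford_def plus_clifford_def algebra_simps sum.distrib)
  show "r *\<^sub>R x \<bullet> y = r * (x \<bullet> y)"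
    by (simp add: inner_clifford_def scaleR_clifford_def algebra_simps sum_distrib_left)
  show "0 \<le> x \<bullet> x"
    by (simp add: inner_clifford_def sum_nonneg)
  show "x \<bullet> x = 0 \<longleftrightarrow> x = 0"
    by (simp add: inner_clifford_def clifford_eq_iff zero_clifford_def sum_nonneg_eq_0_iff)
qed (rule dist_clifford_def sgn_clifford_def uniformity_clifford_def open_clifford_def
    norm_clifford_def)+

end

definition basis_blade :: "'m set \<Rightarrow> 'm clifford" where
  "basis_blade A = of_coords (\<lambda>B. if B = A then 1 else 0)"

instantiation clifford :: ("{finite,linorder}") euclidean_space
begin

definition Basis_clifford :: "'a clifford set" where
  "Basis = range basis_blade"

instance
proof
  show "(Basis :: 'a clifford set) \<noteq> {}" "finite (Basis :: 'a clifford set)"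
    by (simp_all add: Basis_clifford_def)
next
  fix u v :: "'a clifford"
  assume "u \<in> Basis" "v \<in> Basis"
  then show "u \<bullet> v = (if u = v then 1 else 0)"
    by (force simp: Basis_clifford_def basis_blade_def inner_clifford_def clifford_eq_iff
        mult_delta_left mult_delta_right)
next
  fix x :: "'a clifford"
  show "(\<forall>u\<in>Basis. x \<bullet> u = 0) \<longleftrightarrow> x = 0"
    by (simp add: Basis_clifford_def basis_blade_def inner_clifford_def clifford_eq_iff
        zero_clifford_def mult_delta_left mult_delta_right)
qed

end

definition e_gen :: "'m \<Rightarrow> 'm::{finite,linorder} clifford" where
  "e_gen j = basis_blade {j}"

definition e_prod :: "'m set \<Rightarrow> 'm::{finite,linorder} clifford" where
  "e_prod A = prod_list (map e_gen (sorted_list_of_set A))"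

lemma basis_blade_mult:
  "basis_blade A * basis_blade B = blade_sign A B *\<^sub>R basis_blade (sym_diff A B)"
  unfolding clifford_eq_iff
proof
  fix C
  have "coords (basis_blade A * basis_blade B) C =
      (\<Sum>X\<in>UNIV. if X = A then if sym_diff A C = B then blade_sign A B else 0 else 0)"
    unfolding basis_blade_def times_clifford_def coords_of_coords
    by (rule sum.cong) auto
  then have "coords (basis_blade A * basis_blade B) C =
      (if sym_diff A C = B then blade_sign A B else 0)"
    by simp
  moreover have "sym_diff A C = B \<longleftrightarrow> C = sym_diff A B"
    by auto
  ultimately show "coords (basis_blade A * basis_blade B) C =
      coords (blade_sign A B *\<^sub>R basis_blade (sym_diff A B)) C"
    by (simp add: basis_blade_def scaleR_clifford_def)
qed

lemma basis_blade_empty: "basis_blade {} = 1"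
  by (simp add: basis_blade_def one_clifford_def)

text \<open>The defining relations, and the identification of the coordinate basis with the \<open>e\<^sub>A\<close>.\<close>

lemma e_relations: "e_gen j * e_gen k + e_gen k * e_gen j = (if j = k then - 2 else 0)"
proof (cases "j = k")
  case True
  have "e_gen k * e_gen k = - 1"
    by (simp add: e_gen_def basis_blade_mult blade_sign_def basis_blade_empty)
  with True show ?thesis
    by simp
next
  case False
  then have "sym_diff {j} {k} = {j, k}" "sym_diff {k} {j} = {j, k}"
    by auto
  with False show ?thesis
    by (cases "j < k") (auto simp: e_gen_def basis_blade_mult blade_sign_def)
qed

lemma e_prod_eq_basis_blade: "e_prod A = basis_blade A"
proof -
  have "prod_list (map e_gen xs) = basis_blade (set xs)" if "sorted xs" "distinct xs" for xs :: "'a list"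
    using that
  proof (induction xs)
    case Nil
    then show ?case
      by (simp add: basis_blade_empty)
  next
    case (Cons a xs)
    then have "sym_diff {a} (set xs) = insert a (set xs)" "\<forall>b\<in>set xs. \<not> b \<le> a"
      by (auto simp: order.antisym)
    with Cons show ?case
      by (simp add: e_gen_def basis_blade_mult blade_sign_def)
  qed
  from this [of "sorted_list_of_set A"] show ?thesis
    by (simp add: e_prod_def)
qed

definition multivectors :: "nat \<Rightarrow> 'm::{finite,linorder} clifford set" where
  "multivectors l = span {e_prod A | A. card A = l}"

definition cvec :: "real ^ 'm::{finite,linorder} \<Rightarrow> 'm clifford" where
  "cvec x = (\<Sum>j\<in>UNIV. (x $ j) *\<^sub>R e_gen j)"


section \<open>Dirac operator and monogenic functions\<close>

definition partial_deriv ::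
  "'m \<Rightarrow> (real ^ 'm::finite \<Rightarrow> 'b) \<Rightarrow> real ^ 'm::finite \<Rightarrow> 'b::real_normed_vector" where
  "partial_deriv j f x = vector_derivative (\<lambda>t. f (x + t *\<^sub>R axis j 1)) (at 0)"

definition dirac_left ::
  "(real ^ 'm::{finite,linorder} \<Rightarrow> 'm clifford) \<Rightarrow> real ^ 'm::{finite,linorder} \<Rightarrow> 'm clifford" where
  "dirac_left f x = (\<Sum>j\<in>UNIV. e_gen j * partial_deriv j f x)"

definition dirac_right ::
  "(real ^ 'm::{finite,linorder} \<Rightarrow> 'm clifford) \<Rightarrow> real ^ 'm::{finite,linorder} \<Rightarrow> 'm clifford" where
  "dirac_right f x = (\<Sum>j\<in>UNIV. partial_deriv j f x * e_gen j)"

definition continuously_differentiable_on ::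
  "('a::real_normed_vector \<Rightarrow> 'b::real_normed_vector) \<Rightarrow> 'a set \<Rightarrow> bool" where
  "continuously_differentiable_on f U \<longleftrightarrow>
     (\<exists>f' :: 'a \<Rightarrow> 'a \<Rightarrow>\<^sub>L 'b. continuous_on U f' \<and>
        (\<forall>x\<in>U. (f has_derivative blinfun_apply (f' x)) (at x)))"

definition two_sided_monogenic_on ::
  "(real \<times> (real ^ 'm::{finite,linorder}) \<Rightarrow> 'm clifford) \<Rightarrow> (real \<times> (real ^ 'm::{finite,linorder})) set \<Rightarrow> bool" where
  "two_sided_monogenic_on f U \<longleftrightarrow> open U \<and> continuously_differentiable_on f U \<and>
     (\<forall>(x0, x)\<in>U.
        vector_derivative (\<lambda>t. f (t, x)) (at x0) + dirac_left (\<lambda>y. f (x0, y)) x = 0 \<and>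
        vector_derivative (\<lambda>t. f (t, x)) (at x0) + dirac_right (\<lambda>y. f (x0, y)) x = 0)"

definition homogeneous_polynomial ::
  "nat \<Rightarrow> ('a::real_normed_vector \<Rightarrow> 'b::real_normed_vector) \<Rightarrow> bool" where
  "homogeneous_polynomial k P \<longleftrightarrow>
     polynomial_function P \<and> (\<forall>t x. P (t *\<^sub>R x) = t ^ k *\<^sub>R P x)"

definition left_monogenic_polys :: "nat \<Rightarrow> (real ^ 'm::{finite,linorder} \<Rightarrow> 'm clifford) set" where
  "left_monogenic_polys k = {P. homogeneous_polynomial k P \<and> (\<forall>x. dirac_left P x = 0)}"

text \<open>For polynomial \<open>g\<close> only finitely many terms of the series are nonzero.\<close>

definition CK ::
  "(real ^ 'm::{finite,linorder} \<Rightarrow> 'm clifford) \<Rightarrow> real \<times> (real ^ 'm::{finite,linorder}) \<Rightarrow> 'm clifford" where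
  "CK g = (\<lambda>(x0, x). \<Sum>n. ((- x0) ^ n / fact n) *\<^sub>R (dirac_left ^^ n) g x)"

text \<open>\<open>W\<close> is the domain, in the variables \<open>(x\<^sub>0, r)\<close>, of the coefficient functions.\<close>

definition axial_two_sided_monogenic_on ::
  "(real \<times> (real ^ 'm::{finite,linorder}) \<Rightarrow> 'm clifford) \<Rightarrow> (real \<times> real) set \<Rightarrow> bool" where
  "axial_two_sided_monogenic_on f W \<longleftrightarrow>
     open W \<and> W \<subseteq> {(x1, x2). x2 > 0} \<and>
     two_sided_monogenic_on f {(x0, x). (x0, norm x) \<in> W} \<and>
     (\<exists>k l P (A :: real \<times> real \<Rightarrow> real) B C D.
        l \<le> CARD('m) \<and> P \<in> left_monogenic_polys k \<and> range P \<subseteq> multivectors l \<and>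
        continuously_differentiable_on A W \<and> continuously_differentiable_on B W \<and>
        continuously_differentiable_on C W \<and> continuously_differentiable_on D W \<and>
        (\<forall>x0 x. (x0, norm x) \<in> W \<longrightarrow>
           f (x0, x) = A (x0, norm x) *\<^sub>R P x + B (x0, norm x) *\<^sub>R (cvec x * P x)
             + C (x0, norm x) *\<^sub>R (P x * cvec x) + D (x0, norm x) *\<^sub>R (cvec x * P x * cvec x)))"

definition mu :: "nat \<Rightarrow> nat \<Rightarrow> real" where
  "mu m l = (- 1) ^ l * (2 * real l - real m)"

definition alpha :: "nat \<Rightarrow> nat \<Rightarrow> nat \<Rightarrow> nat \<Rightarrow> real" where
  "alpha m k n l = - (2 * real k + 2 * real n + real m - mu m l) / (2 * real n)"

end

theory Submission
  imports Defs
begin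

text \<open>
  Let \<open>\<mu> = \<mu>\<^sub>\<ell>\<close>, let \<open>q\<^sub>0 = P\<close> with \<open>P\<close> an \<open>\<ell>\<close>-vector valued element of \<open>M\<^sub>l(k)\<close>, and let \<open>q\<^sub>i\<close> be the initial
  value of degree \<open>k + i\<close> in the theorem that is built from \<open>P\<close>. The left and right Dirac operators
  agree on \<open>q\<^sub>i\<close> (by reversion) and send it to \<open>c\<^sub>i q\<^sub>i\<^sub>-\<^sub>1\<close>, where \<open>c\<^sub>1 = \<mu> - m - 2k\<close>,
  \<open>c\<^sub>2\<^sub>n = - (m + 2k + 2n)\<close> and \<open>c\<^sub>2\<^sub>n\<^sub>+\<^sub>1 = 2n\<close>. Hence the time derivative of \<open>CK[q\<^sub>i]\<close> is \<open>- c\<^sub>i CK[q\<^sub>i\<^sub>-\<^sub>1]\<close>.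

  Given \<open>f\<close> of degree \<open>d + 1\<close>, its time derivative is two-sided monogenic of degree \<open>d\<close>, hence by
  induction a sum of such extensions. Each of them has an antiderivative of the same kind, and
  subtracting these from \<open>f\<close> leaves a function of \<open>x\<close> alone that is annihilated by both
  Dirac operators; so is each of its graded components, which are therefore admissible \<open>P\<close>.

  The antiderivative can only be missing if \<open>c\<^sub>i = 0\<close>, that is for \<open>i = 1\<close>, \<open>k = 0\<close> and \<open>\<ell> = m\<close>
  even. In this case pseudoscalars anticommute with vectors, and comparing the two
  Cauchy-Riemann equations shows that the time derivative of \<open>f\<close> has no pseudoscalar part.
\<close>

section \<open>Derivatives of polynomial functions\<close>

text \<open>Structural induction yields existence, polynomiality and symmetry of the second
  derivative together: linear and constant functions have second derivative 0, and applying the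
  product rule twice gives an expression whose two mixed terms trade places. The direction is the
  first argument of \<open>f'\<close> so that \<open>f' v\<close> can itself be called
  polynomial.\<close>

lemma real_polynomial_function_derivs:
  assumes "real_polynomial_function f"
  shows "\<exists>f' f''. (\<forall>x. (f has_derivative (\<lambda>v. f' v x)) (at x)) \<and>
    (\<forall>v. real_polynomial_function (f' v)) \<and>
    (\<forall>v x. (f' v has_derivative (\<lambda>u. f'' u v x)) (at x)) \<and>
    (\<forall>u v x. f'' u v x = (f'' v u x :: real))"
  using assms
proof induction
  case (linear f)
  then show ?case
    by (intro exI [of _ "\<lambda>v x. f v"] exI [of _ "\<lambda>u v x. 0"])
      (auto intro: bounded_linear_imp_has_derivative)
next
  case (const c)
  show ?case
    by (intro exI [of _ "\<lambda>v x. 0"] exI [of _ "\<lambda>u v x. 0"]) auto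
next
  case (add f g)
  obtain f' f''
    where [derivative_intros]: "\<And>x. (f has_derivative (\<lambda>v. f' v x)) (at x)"
        "\<And>v x. (f' v has_derivative (\<lambda>u. f'' u v x)) (at x)"
      and f: "\<And>v. real_polynomial_function (f' v)" "\<And>u v x. f'' u v x = f'' v u x"
    using add.IH(1) by blast
  obtain g' g''
    where [derivative_intros]: "\<And>x. (g has_derivative (\<lambda>v. g' v x)) (at x)"
        "\<And>v x. (g' v has_derivative (\<lambda>u. g'' u v x)) (at x)"
      and g: "\<And>v. real_polynomial_function (g' v)" "\<And>u v x. g'' u v x = g'' v u x"
    using add.IH(2) by blast
  have "((\<lambda>x. f' v x + g' v x) has_derivative (\<lambda>u. f'' u v x + g'' u v x)) (at x)" for v x
    by (intro derivative_intros)
  moreover have "((\<lambda>x. f x + g x) has_derivative (\<lambda>v. f' v x + g' v x)) (at x)" for x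
    by (intro derivative_intros)
  ultimately show ?case
    by (intro exI [of _ "\<lambda>v x. f' v x + g' v x"] exI [of _ "\<lambda>u v x. f'' u v x + g'' u v x"] conjI allI)
      (use f(1) g(1) in \<open>auto simp: f(2) [of _ _ x for x] g(2) [of _ _ x for x]\<close>)
next
  case (mult f g)
  obtain f' f''
    where [derivative_intros]: "\<And>x. (f has_derivative (\<lambda>v. f' v x)) (at x)"
        "\<And>v x. (f' v has_derivative (\<lambda>u. f'' u v x)) (at x)"
      and f: "\<And>v. real_polynomial_function (f' v)" "\<And>u v x. f'' u v x = f'' v u x"
    using mult.IH(1) by blast
  obtain g' g''
    where [derivative_intros]: "\<And>x. (g has_derivative (\<lambda>v. g' v x)) (at x)"
        "\<And>v x. (g' v has_derivative (\<lambda>u. g'' u v x)) (at x)"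
      and g: "\<And>v. real_polynomial_function (g' v)" "\<And>u v x. g'' u v x = g'' v u x"
    using mult.IH(2) by blast
  have "((\<lambda>x. f x * g' v x + f' v x * g x) has_derivative
      (\<lambda>u. (f x * g'' u v x + f' u x * g' v x) + (f' v x * g' u x + f'' u v x * g x))) (at x)" for v x
    by (intro derivative_intros)
  moreover have "((\<lambda>x. f x * g x) has_derivative (\<lambda>v. f x * g' v x + f' v x * g x)) (at x)" for x
    by (intro derivative_intros)
  moreover have "real_polynomial_function (\<lambda>x. f x * g' v x + f' v x * g x)" for v
    by (intro real_polynomial_function.intros(3,4) f g mult.hyps)
  moreover have "(f x * g'' u v x + f' u x * g' v x) + (f' v x * g' u x + f'' u v x * g x) =
      (f x * g'' v u x + f' v x * g' u x) + (f' u x * g' v x + f'' v u x * g x)" for u v x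
    using f(2) [of u v x] g(2) [of u v x] by simp
  ultimately show ?case
    by (intro exI [of _ "\<lambda>v x. f x * g' v x + f' v x * g x"]
        exI [of _ "\<lambda>u v x. (f x * g'' u v x + f' u x * g' v x) + (f' v x * g' u x + f'' u v x * g x)"]
        conjI allI)
qed

text \<open>With the direction as first argument, \<open>dir_deriv v\<close> is an operator on
  functions and can be iterated. On the product space the directions \<open>(1, 0)\<close> and
  \<open>(0, axis j 1)\<close> give all partial derivatives.\<close>

definition dir_deriv :: "'a::real_normed_vector \<Rightarrow> ('a \<Rightarrow> 'b::real_normed_vector) \<Rightarrow> 'a \<Rightarrow> 'b" where
  "dir_deriv v f x = frechet_derivative f (at x) v"

lemma dir_deriv_eqI: "(f has_derivative f') (at x) \<Longrightarrow> dir_deriv v f x = f' v"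
  unfolding dir_deriv_def by (metis frechet_derivative_at)

context
  fixes f :: "'a::real_normed_vector \<Rightarrow> 'b::euclidean_space"
  assumes f: "polynomial_function f"
begin

text \<open>All three hold coordinatewise: the scalar result supplies first and second derivatives
  of \<open>f x \<bullet> b\<close> for each basis vector \<open>b\<close>, and \<open>f\<close> is
  reassembled from these.\<close>

lemma has_derivative_dir_deriv: "(f has_derivative (\<lambda>v. dir_deriv v f x)) (at x)"
  and polynomial_function_dir_deriv: "polynomial_function (dir_deriv v f)"
  and dir_deriv_commute: "dir_deriv u (dir_deriv v f) x = dir_deriv v (dir_deriv u f) x"
proof -
  have "\<forall>b\<in>Basis. \<exists>f' f''. (\<forall>x. ((\<lambda>x. f x \<bullet> b) has_derivative (\<lambda>v. f' v x)) (at x)) \<and>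
    (\<forall>v. real_polynomial_function (f' v)) \<and>
    (\<forall>v x. (f' v has_derivative (\<lambda>u. f'' u v x)) (at x)) \<and>
    (\<forall>u v x. f'' u v x = (f'' v u x :: real))"
    using f by (intro ballI real_polynomial_function_derivs) (simp add: polynomial_function_iff_Basis_inner)
  from bchoice [OF this] obtain f' where "\<forall>b\<in>Basis. \<exists>f''.
    (\<forall>x. ((\<lambda>x. f x \<bullet> b) has_derivative (\<lambda>v. f' b v x)) (at x)) \<and>
    (\<forall>v. real_polynomial_function (f' b v)) \<and>
    (\<forall>v x. (f' b v has_derivative (\<lambda>u. f'' u v x)) (at x)) \<and>
    (\<forall>u v x. f'' u v x = (f'' v u x :: real))" ..
  from bchoice [OF this] obtain f'' where "\<forall>b\<in>Basis.
    (\<forall>x. ((\<lambda>x. f x \<bullet> b) has_derivative (\<lambda>v. f' b v x)) (at x)) \<and>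
    (\<forall>v. real_polynomial_function (f' b v)) \<and>
    (\<forall>v x. (f' b v has_derivative (\<lambda>u. f'' b u v x)) (at x)) \<and>
    (\<forall>u v x. f'' b u v x = (f'' b v u x :: real))" ..
  note derivs = bspec [OF this]
  note * = derivs [THEN conjunct1, rule_format]
    derivs [THEN conjunct2, THEN conjunct1, rule_format]
    derivs [THEN conjunct2, THEN conjunct2, THEN conjunct1, rule_format]
    derivs [THEN conjunct2, THEN conjunct2, THEN conjunct2, rule_format]
  have "((\<lambda>x. \<Sum>b\<in>Basis. (f x \<bullet> b) *\<^sub>R b) has_derivative (\<lambda>v. \<Sum>b\<in>Basis. f' b v x *\<^sub>R b)) (at x)" for x
    by (rule has_derivative_sum, rule has_derivative_scaleR_left, rule *(1))
  then have deriv: "(f has_derivative (\<lambda>v. \<Sum>b\<in>Basis. f' b v x *\<^sub>R b)) (at x)" for x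
    by (simp add: euclidean_representation)
  then have d: "dir_deriv v f = (\<lambda>x. \<Sum>b\<in>Basis. f' b v x *\<^sub>R b)" for v
    by (intro ext dir_deriv_eqI [OF deriv])
  show "(f has_derivative (\<lambda>v. dir_deriv v f x)) (at x)"
    using deriv by (simp add: d)
  show "polynomial_function (dir_deriv v f)"
    unfolding d
    by (intro polynomial_function_sum polynomial_function_mult)
      (simp_all add: *(2) real_polynomial_function_eq [symmetric])
  have "(dir_deriv v f has_derivative (\<lambda>u. \<Sum>b\<in>Basis. f'' b u v x *\<^sub>R b)) (at x)" for v x
    unfolding d by (rule has_derivative_sum, rule has_derivative_scaleR_left, rule *(3))
  then have dd: "dir_deriv u (dir_deriv v f) x = (\<Sum>b\<in>Basis. f'' b u v x *\<^sub>R b)" for u v x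
    by (rule dir_deriv_eqI)
  show "dir_deriv u (dir_deriv v f) x = dir_deriv v (dir_deriv u f) x"
    unfolding dd by (rule sum.cong) (auto simp: *(4) [of _ u v])
qed

lemma dir_deriv_scaleR: "dir_deriv (c *\<^sub>R v) f x = c *\<^sub>R dir_deriv v f x"
  by (rule linear_scale [OF has_derivative_linear [OF has_derivative_dir_deriv]])

lemma has_vector_derivative_dir_deriv:
  "((\<lambda>t. f (x + t *\<^sub>R v)) has_vector_derivative dir_deriv v f (x + s *\<^sub>R v)) (at s)"
proof -
  have "((\<lambda>t. f (x + t *\<^sub>R v)) has_derivative (\<lambda>h. dir_deriv (h *\<^sub>R v) f (x + s *\<^sub>R v))) (at s)"
    by (rule has_derivative_compose [OF _ has_derivative_dir_deriv])
      (rule derivative_eq_intros refl | simp)+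
  then show ?thesis
    by (simp add: has_vector_derivative_def dir_deriv_scaleR)
qed

end

text \<open>In finite dimension a function into the linear maps is continuous as soon as its value
  on each basis vector is; here these values are the polynomials
  \<open>dir_deriv v f\<close>.\<close>

lemma polynomial_function_imp_continuously_differentiable_on:
  fixes f :: "'a::euclidean_space \<Rightarrow> 'b::euclidean_space"
  assumes "polynomial_function f"
  shows "continuously_differentiable_on f U"
proof -
  have app: "blinfun_apply (Blinfun (\<lambda>v. dir_deriv v f x)) = (\<lambda>v. dir_deriv v f x)" for x
    by (rule bounded_linear_Blinfun_apply)
      (rule has_derivative_bounded_linear [OF has_derivative_dir_deriv [OF assms]])
  have "continuous_on U (\<lambda>x. Blinfun (\<lambda>v. dir_deriv v f x))"
    by (rule continuous_on_blinfun_componentwise)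
      (auto simp: app intro!: continuous_on_polymonial_function polynomial_function_dir_deriv assms)
  then show ?thesis
    unfolding continuously_differentiable_on_def
    by (intro exI [of _ "\<lambda>x. Blinfun (\<lambda>v. dir_deriv v f x)"])
      (auto simp: app intro: has_derivative_dir_deriv assms)
qed

text \<open>For nonzero \<open>t\<close> the factor is moved onto the direction,
  \<open>f (t x + s v) = t^(d+1) f (x + s v / t)\<close>, and differentiated in \<open>s\<close>;
  linearity in the direction then loses one power of \<open>t\<close>.\<close>

lemma homogeneous_polynomial_dir_deriv:
  fixes f :: "'a::real_normed_vector \<Rightarrow> 'b::euclidean_space"
  assumes "homogeneous_polynomial (Suc d) f"
  shows "homogeneous_polynomial d (dir_deriv v f)"
  unfolding homogeneous_polynomial_def
proof (intro conjI allI)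
  have poly: "polynomial_function f" and hom: "f (t *\<^sub>R x) = t ^ Suc d *\<^sub>R f x" for t x
    using assms by (auto simp: homogeneous_polynomial_def)
  show poly': "polynomial_function (dir_deriv v f)"
    by (rule polynomial_function_dir_deriv [OF poly])
  fix t x
  have *: "dir_deriv v f (t *\<^sub>R x) = t ^ d *\<^sub>R dir_deriv v f x" if "t \<noteq> 0" for t
  proof -
    have "(\<lambda>s. f (t *\<^sub>R x + s *\<^sub>R v)) = (\<lambda>s. t ^ Suc d *\<^sub>R f (x + s *\<^sub>R (v /\<^sub>R t)))"
    proof
      fix s
      have "t *\<^sub>R x + s *\<^sub>R v = t *\<^sub>R (x + s *\<^sub>R (v /\<^sub>R t))"
        using that by (simp add: scaleR_add_right)
      then show "f (t *\<^sub>R x + s *\<^sub>R v) = t ^ Suc d *\<^sub>R f (x + s *\<^sub>R (v /\<^sub>R t))"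
        by (simp only: hom)
    qed
    then have "((\<lambda>s. t ^ Suc d *\<^sub>R f (x + s *\<^sub>R (v /\<^sub>R t))) has_vector_derivative
        dir_deriv v f (t *\<^sub>R x)) (at 0)"
      using has_vector_derivative_dir_deriv [OF poly, of "t *\<^sub>R x" v 0] by simp
    moreover have "((\<lambda>s. t ^ Suc d *\<^sub>R f (x + s *\<^sub>R (v /\<^sub>R t))) has_vector_derivative
        t ^ Suc d *\<^sub>R dir_deriv (v /\<^sub>R t) f x) (at 0)"
      using has_vector_derivative_dir_deriv [OF poly, of x "v /\<^sub>R t" 0]
      by (intro bounded_linear.has_vector_derivative [OF bounded_linear_scaleR_right]) simp
    ultimately have "dir_deriv v f (t *\<^sub>R x) = t ^ Suc d *\<^sub>R dir_deriv (v /\<^sub>R t) f x"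
      by (rule vector_derivative_unique_at)
    then show ?thesis
      using that by (simp add: dir_deriv_scaleR [OF poly])
  qed
  show "dir_deriv v f (t *\<^sub>R x) = t ^ d *\<^sub>R dir_deriv v f x"
  proof (cases "t = 0")
    case True
    have "isCont (dir_deriv v f) (0 *\<^sub>R x)"
      using continuous_on_polymonial_function [OF poly', of UNIV] by (simp add: continuous_on_eq_continuous_at)
    then have "(\<lambda>s. dir_deriv v f (s *\<^sub>R x)) \<midarrow>0\<rightarrow> dir_deriv v f (0 *\<^sub>R x)"
      by (rule isCont_tendsto_compose) (intro tendsto_intros)
    moreover have "\<forall>\<^sub>F s in at (0::real). dir_deriv v f (s *\<^sub>R x) = s ^ d *\<^sub>R dir_deriv v f x"
      using * by (auto simp: eventually_at_filter)
    ultimately have "(\<lambda>s. s ^ d *\<^sub>R dir_deriv v f x) \<midarrow>0\<rightarrow> dir_deriv v f (0 *\<^sub>R x)"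
      by (rule Lim_transform_eventually)
    moreover have "(\<lambda>s. s ^ d *\<^sub>R dir_deriv v f x) \<midarrow>0\<rightarrow> 0 ^ d *\<^sub>R dir_deriv v f x"
      by (intro tendsto_intros)
    ultimately have "dir_deriv v f (0 *\<^sub>R x) = 0 ^ d *\<^sub>R dir_deriv v f x"
      by (rule tendsto_unique [OF at_neq_bot])
    then show ?thesis
      using True by simp
  next
    case False
    then show ?thesis
      by (rule *)
  qed
qed

text \<open>Euler's relation: both sides are the derivative at \<open>t = 1\<close> of
  \<open>f (t x) = t^d f x\<close>.\<close>

lemma homogeneous_polynomial_euler:
  fixes f :: "'a::real_normed_vector \<Rightarrow> 'b::euclidean_space"
  assumes "homogeneous_polynomial d f"
  shows "dir_deriv x f x = real d *\<^sub>R f x"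
proof -
  have poly: "polynomial_function f" and hom: "f (t *\<^sub>R x) = t ^ d *\<^sub>R f x" for t x
    using assms by (auto simp: homogeneous_polynomial_def)
  have "((\<lambda>t. f (t *\<^sub>R x)) has_vector_derivative dir_deriv x f x) (at 1)"
    using has_vector_derivative_dir_deriv [OF poly, of 0 x 1] by simp
  moreover have "((\<lambda>t. t ^ d *\<^sub>R f x) has_vector_derivative real d *\<^sub>R f x) (at 1)"
    by (auto intro!: derivative_eq_intros simp: has_vector_derivative_def)
  ultimately show ?thesis
    unfolding hom by (rule vector_derivative_unique_at)
qed

section \<open>Reversion and grades\<close>

lemma coords_simps [simp]:
  "coords 0 A = 0" "coords (x + y) A = coords x A + coords y A"
  "coords (x - y) A = coords x A - coords y A" "coords (- x) A = - coords x A"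
  "coords (r *\<^sub>R x) A = r * coords x A"
  by (simp_all add: clifford_op_defs)

lemma coords_sum: "coords (sum f I) A = (\<Sum>i\<in>I. coords (f i) A)"
  by (induction I rule: infinite_finite_induct) auto

lemma bounded_linear_coords: "bounded_linear (\<lambda>x. coords x A)"
  by (simp add: linear_conv_bounded_linear [symmetric] linear_iff)

lemma blade_expansion: "x = (\<Sum>A\<in>UNIV. coords x A *\<^sub>R basis_blade A)"
  by (simp add: clifford_eq_iff coords_sum basis_blade_def mult_delta_right)

lemma multivectors_iff: "x \<in> multivectors l \<longleftrightarrow> (\<forall>A. card A \<noteq> l \<longrightarrow> coords x A = 0)"
proof
  assume "x \<in> multivectors l"
  then show "\<forall>A. card A \<noteq> l \<longrightarrow> coords x A = 0"
    unfolding multivectors_def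
    by (induction rule: span_induct_alt) (auto simp: e_prod_eq_basis_blade basis_blade_def split: if_splits)
next
  assume *: "\<forall>A. card A \<noteq> l \<longrightarrow> coords x A = 0"
  have "coords x A *\<^sub>R basis_blade A \<in> multivectors l" for A
    using * by (cases "card A = l")
      (auto simp: multivectors_def e_prod_eq_basis_blade intro: span_scale span_base span_zero)
  then have "(\<Sum>A\<in>UNIV. coords x A *\<^sub>R basis_blade A) \<in> multivectors l"
    unfolding multivectors_def by (intro span_sum) auto
  then show "x \<in> multivectors l"
    using blade_expansion [of x] by simp
qed

text \<open>The product formula collapses to the single term \<open>A = {j}\<close>, so
  multiplication by \<open>e_gen j\<close> toggles \<open>j\<close> in the index set. The later sign
  and grade computations rest on this.\<close>

lemma coords_e_gen_mult:
  "coords (e_gen j * x) C = blade_sign {j} (sym_diff {j} C) * coords x (sym_diff {j} C)"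
proof -
  have "coords (e_gen j * x) C =
      (\<Sum>A\<in>UNIV. if A = {j} then blade_sign {j} (sym_diff {j} C) * coords x (sym_diff {j} C) else 0)"
    unfolding times_clifford_def coords_of_coords e_gen_def basis_blade_def
    by (rule sum.cong) auto
  then show ?thesis
    by simp
qed

lemma coords_mult_e_gen:
  "coords (x * e_gen j) C = blade_sign (sym_diff {j} C) {j} * coords x (sym_diff {j} C)"
proof -
  have eq: "sym_diff A C = {j} \<longleftrightarrow> A = sym_diff {j} C" for A
    by auto
  have "blade_sign A E * a * (if E = {j} then 1 else 0) =
      (if E = {j} then blade_sign A {j} * a else 0)" for A E a
    by simp
  then have "coords (x * e_gen j) C =
      (\<Sum>A\<in>UNIV. if A = sym_diff {j} C then blade_sign A {j} * coords x A else 0)"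
    by (simp only: times_clifford_def coords_of_coords e_gen_def basis_blade_def eq)
  then show ?thesis
    by simp
qed

text \<open>For \<open>a \<noteq> j\<close> exactly one of \<open>a \<le> j\<close> and
  \<open>j \<le> a\<close> holds, so reversing the order costs a factor \<open>-1\<close> for each
  such \<open>a\<close>; for \<open>a = j\<close> both hold and no sign arises.\<close>

lemma blade_sign_swap:
  "blade_sign A {j} = (- 1) ^ (card A + (if j \<in> A then 1 else 0)) * blade_sign {j} A"
proof -
  have "blade_sign A {j} =
      (\<Prod>a\<in>A. (- 1) * ((if j = a then - 1 else 1) * (if a \<le> j then - 1 else (1::real))))"
    unfolding blade_sign_def by (rule prod.cong) auto
  also have "\<dots> = (- 1) ^ card A * ((if j \<in> A then - 1 else 1) * blade_sign {j} A)"
    unfolding prod.distrib blade_sign_def by simp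
  finally show ?thesis
    by simp
qed

text \<open>The sign of reversing a product of \<open>l\<close> distinct anticommuting generators,
  which takes \<open>l (l - 1) / 2\<close> transpositions.\<close>

definition reversion_sign :: "nat \<Rightarrow> real" where
  "reversion_sign l = (- 1) ^ (l * (l - 1) div 2)"

lemma reversion_sign_Suc: "reversion_sign (Suc l) = (- 1) ^ l * reversion_sign l"
proof -
  have "Suc l * (Suc l - 1) div 2 = l + l * (l - 1) div 2"
    by (cases l) (auto simp: algebra_simps)
  then show ?thesis
    by (simp add: reversion_sign_def power_add)
qed

lemma reversion_sign_square: "reversion_sign l * reversion_sign l = 1"
  by (simp add: reversion_sign_def power_mult_distrib [symmetric])

text \<open>The anti-automorphism that reverses products of generators, given by its sign on each
  blade.\<close>

definition reversion :: "'m clifford \<Rightarrow> 'm::{finite,linorder} clifford" where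
  "reversion x = of_coords (\<lambda>A. reversion_sign (card A) * coords x A)"

lemma coords_reversion [simp]: "coords (reversion x) A = reversion_sign (card A) * coords x A"
  by (simp add: reversion_def)

lemma linear_reversion: "linear reversion"
  by (simp add: linear_iff clifford_eq_iff algebra_simps)

lemma reversion_reversion [simp]: "reversion (reversion x) = x"
  by (simp add: clifford_eq_iff mult.assoc [symmetric] reversion_sign_square)

lemma reversion_multivector: "x \<in> multivectors l \<Longrightarrow> reversion x = reversion_sign l *\<^sub>R x"
  by (auto simp: clifford_eq_iff multivectors_iff)

text \<open>If \<open>s\<close> is the grade of the smaller of the two blades involved, the sign
  \<open>(- 1) ^ s\<close> arises twice, from \<open>reversion_sign_Suc\<close> and from
  \<open>blade_sign_swap\<close>, and cancels.\<close>

lemma reversion_e_gen_mult: "reversion (e_gen j * x) = reversion x * e_gen j"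
  unfolding clifford_eq_iff
proof
  fix C :: "'a set"
  show "coords (reversion (e_gen j * x)) C = coords (reversion x * e_gen j) C"
  proof (cases "j \<in> C")
    case True
    then obtain D where "C = insert j D" "j \<notin> D"
      by (meson mk_disjoint_insert)
    moreover from this have "sym_diff {j} C = D"
      by auto
    ultimately show ?thesis
      by (simp add: coords_e_gen_mult coords_mult_e_gen blade_sign_swap reversion_sign_Suc)
  next
    case False
    then have "sym_diff {j} C = insert j C" "card (insert j C) = Suc (card C)"
      by auto
    then show ?thesis
      by (simp add: coords_e_gen_mult coords_mult_e_gen blade_sign_swap reversion_sign_Suc
          power_add [symmetric])
  qed
qed

lemma reversion_cvec_mult: "reversion (cvec v * x) = reversion x * cvec v"
  by (simp add: cvec_def sum_distrib_left sum_distrib_right linear_sum [OF linear_reversion]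
      linear_scale [OF linear_reversion] reversion_e_gen_mult)

lemma reversion_mult_cvec: "reversion (x * cvec v) = cvec v * reversion x"
  by (metis reversion_cvec_mult reversion_reversion)

section \<open>Conjugation by generators and the square of a vector\<close>

lemma e_gen_square [simp]: "e_gen j * e_gen j = - 1"
  by (simp add: e_gen_def basis_blade_mult blade_sign_def basis_blade_empty)

text \<open>On a blade of grade \<open>l\<close> that contains \<open>j\<close>, conjugation by
  \<open>e_gen j\<close> gives the sign \<open>(- 1) ^ l\<close>, otherwise the opposite sign. With
  \<open>l\<close> indices of the first kind and \<open>m - l\<close> of the second, the signs add
  up to \<mu>.\<close>

lemma sum_e_gen_conj:
  fixes x :: "'m::{finite,linorder} clifford"
  assumes "x \<in> multivectors l"
  shows "(\<Sum>j\<in>UNIV. e_gen j * x * e_gen j) = mu CARD('m) l *\<^sub>R x"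
  unfolding clifford_eq_iff coords_sum
proof
  fix C :: "'m set"
  have *: "coords (e_gen j * x * e_gen j) C = (- 1) ^ l * (if j \<in> C then 1 else - 1) * coords x C" for j
  proof (cases "card C = l")
    case True
    have "e_gen j * x * e_gen j = e_gen j * (x * e_gen j)"
      by (simp add: mult.assoc)
    moreover have "blade_sign {j} (sym_diff {j} C) = (if j \<le> j then - 1 else 1) * blade_sign {j} C"
      by (simp only: blade_sign_sym_diff_right) (simp add: blade_sign_def)
    ultimately show ?thesis
      using True blade_sign_square [of "{j}" C]
      by (auto simp: coords_e_gen_mult coords_mult_e_gen blade_sign_swap algebra_simps)
  next
    case False
    with assms show ?thesis
      by (simp add: multivectors_iff mult.assoc coords_e_gen_mult coords_mult_e_gen)
  qed
  have "(\<Sum>j\<in>UNIV. if j \<in> C then 1 else - 1 :: real) = 2 * real (card C) - real CARD('m)"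
  proof -
    have "(\<Sum>j\<in>UNIV. if j \<in> C then 1 else - 1 :: real) = (\<Sum>j\<in>UNIV. 2 * (if j \<in> C then 1 else 0) - 1)"
      by (rule sum.cong) auto
    moreover have "(\<Sum>j\<in>UNIV. if j \<in> C then 1 else 0 :: real) = real (card C)"
      by (simp add: sum.If_cases)
    ultimately show ?thesis
      by (simp add: sum_subtractf sum_distrib_left [symmetric])
  qed
  then have "(\<Sum>j\<in>UNIV. coords (e_gen j * x * e_gen j) C) =
      (- 1) ^ l * (2 * real (card C) - real CARD('m)) * coords x C"
    unfolding * by (simp flip: sum_distrib_left sum_distrib_right)
  then show "(\<Sum>j\<in>UNIV. coords (e_gen j * x * e_gen j) C) = coords (mu CARD('m) l *\<^sub>R x) C"
    using assms by (cases "card C = l") (auto simp: mu_def multivectors_iff)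
qed

lemma e_gen_mult_cvec: "e_gen j * cvec v = - (cvec v * e_gen j) - (2 * v $ j) *\<^sub>R 1"
proof -
  have "e_gen j * cvec v + cvec v * e_gen j = (\<Sum>i\<in>UNIV. (v $ i) *\<^sub>R (e_gen j * e_gen i + e_gen i * e_gen j))"
    by (simp add: cvec_def sum_distrib_left sum_distrib_right sum.distrib scaleR_add_right)
  also have "\<dots> = (\<Sum>i\<in>UNIV. if i = j then (- 2 * v $ i) *\<^sub>R 1 else 0)"
    by (rule sum.cong) (auto simp: e_relations scaleR_conv_of_real mult.commute)
  also have "\<dots> = (- 2 * v $ j) *\<^sub>R 1"
    by simp
  finally have "(e_gen j * cvec v + cvec v * e_gen j) - cvec v * e_gen j =
      (- 2 * v $ j) *\<^sub>R 1 - cvec v * e_gen j"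
    by simp
  then show ?thesis
    by simp
qed

text \<open>Moving each generator of the left factor past \<open>cvec v\<close> gives
  \<open>a = - a - 2 |v|^2\<close> for \<open>a = cvec v * cvec v\<close>, and halving gives the
  claim.\<close>

lemma cvec_square: "cvec v * cvec v = - ((norm v)\<^sup>2 *\<^sub>R 1)"
proof -
  have "(v $ j) *\<^sub>R (e_gen j * cvec v) =
      - (cvec v * ((v $ j) *\<^sub>R e_gen j)) - (2 * (v $ j * v $ j)) *\<^sub>R 1" for j
    by (simp add: e_gen_mult_cvec scaleR_diff_right)
  then have "(\<Sum>j\<in>UNIV. (v $ j) *\<^sub>R e_gen j) * cvec v =
      - (cvec v * (\<Sum>j\<in>UNIV. (v $ j) *\<^sub>R e_gen j)) - (\<Sum>j\<in>UNIV. (2 * (v $ j * v $ j)) *\<^sub>R 1)"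
    by (simp add: sum_distrib_right sum_distrib_left sum_subtractf sum_negf)
  then have "cvec v * cvec v = - (cvec v * cvec v) - (\<Sum>j\<in>UNIV. (2 * (v $ j * v $ j)) *\<^sub>R 1)"
    by (simp only: cvec_def [symmetric])
  moreover have "2 *\<^sub>R a = - b" if "a = - a - b" for a b :: "'a clifford"
  proof -
    have "2 *\<^sub>R a = a + (- a - b)"
      by (subst that [symmetric]) (rule scaleR_2)
    then show ?thesis
      by simp
  qed
  ultimately have "2 *\<^sub>R (cvec v * cvec v) = - (\<Sum>j\<in>UNIV. (2 * (v $ j * v $ j)) *\<^sub>R 1)"
    by blast
  also have "- (\<Sum>j\<in>UNIV. (2 * (v $ j * v $ j)) *\<^sub>R (1 :: 'a clifford)) = 2 *\<^sub>R - ((norm v)\<^sup>2 *\<^sub>R 1)"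
    unfolding power2_norm_eq_inner inner_vec_def inner_real_def
    by (simp add: scaleR_sum_left scaleR_sum_right sum_negf mult.assoc)
  finally show ?thesis
    by (metis real_vector.scale_left_imp_eq zero_neq_numeral)
qed

lemma bounded_bilinear_clifford_mult:
  "bounded_bilinear (\<lambda>x y :: 'm::{finite,linorder} clifford. x * y)"
  by (simp add: bilinear_conv_bounded_bilinear [symmetric] bilinear_def linear_iff algebra_simps)

lemma bounded_linear_cvec: "bounded_linear cvec"
  by (simp add: linear_conv_bounded_linear [symmetric] linear_iff cvec_def scaleR_add_left
      sum.distrib scaleR_sum_right)

section \<open>The Dirac operators on products\<close>

lemma bounded_linear_clifford_mult_left: "bounded_linear (\<lambda>x :: 'm::{finite,linorder} clifford. a * x)"
  and bounded_linear_clifford_mult_right: "bounded_linear (\<lambda>x :: 'm::{finite,linorder} clifford. x * a)"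
  by (simp_all add: linear_conv_bounded_linear [symmetric] linear_iff algebra_simps)

lemma polynomial_function_bounded_linear_compose:
  "bounded_linear h \<Longrightarrow> polynomial_function f \<Longrightarrow> polynomial_function (\<lambda>x. h (f x))"
  using polynomial_function_compose [OF _ polynomial_function_bounded_linear] by (simp add: o_def)

text \<open>Expanding the left factor in blades reduces the Clifford product to real polynomials
  times linear images of \<open>g\<close>.\<close>

lemma polynomial_function_clifford_mult:
  fixes f g :: "'a::real_normed_vector \<Rightarrow> 'm::{finite,linorder} clifford"
  assumes "polynomial_function f" "polynomial_function g"
  shows "polynomial_function (\<lambda>x. f x * g x)"
proof -
  have "polynomial_function (\<lambda>x. \<Sum>A\<in>UNIV. coords (f x) A *\<^sub>R (basis_blade A * g x))"
    by (intro polynomial_function_sum polynomial_function_mult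
        polynomial_function_bounded_linear_compose [OF bounded_linear_coords]
        polynomial_function_bounded_linear_compose [OF bounded_linear_clifford_mult_left] assms) simp
  moreover have "(\<Sum>A\<in>UNIV. coords (f x) A *\<^sub>R (basis_blade A * g x)) = f x * g x" for x
    by (subst (2) blade_expansion) (simp add: sum_distrib_right)
  ultimately show ?thesis
    by simp
qed

lemma norm_power_even: "norm (x :: 'a::real_inner) ^ (2 * n) = (x \<bullet> x) ^ n"
  by (simp add: power_mult power2_norm_eq_inner)

lemma polynomial_function_norm_power:
  "even n \<Longrightarrow> polynomial_function (\<lambda>x :: 'a::euclidean_space. norm x ^ n)"
proof (elim evenE)
  fix k assume "n = 2 * k"
  have "real_polynomial_function (\<lambda>x :: 'a. x \<bullet> x)"
    by (subst euclidean_inner)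
      (rule real_polynomial_function_sum [OF finite_Basis], rule real_polynomial_function.intros(4);
        rule real_polynomial_function.intros(1) [OF bounded_linear_inner_left])
  with \<open>n = 2 * k\<close> show ?thesis
    by (auto simp: norm_power_even real_polynomial_function_eq [symmetric])
qed

section \<open>Homogeneous polynomials under products and sums\<close>

lemma homogeneous_polynomial_clifford_mult:
  fixes f g :: "'a::real_normed_vector \<Rightarrow> 'm::{finite,linorder} clifford"
  assumes "homogeneous_polynomial k f" "homogeneous_polynomial l g"
  shows "homogeneous_polynomial (k + l) (\<lambda>x. f x * g x)"
  using assms by (simp add: homogeneous_polynomial_def polynomial_function_clifford_mult power_add)

lemma homogeneous_polynomial_scaleR:
  assumes "homogeneous_polynomial k f" "homogeneous_polynomial l g"
  shows "homogeneous_polynomial (k + l) (\<lambda>x. f x *\<^sub>R g x)"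
  using assms by (auto simp: homogeneous_polynomial_def power_add)

lemma homogeneous_polynomial_const: "homogeneous_polynomial 0 (\<lambda>x. c)"
  by (simp add: homogeneous_polynomial_def)

lemma homogeneous_polynomial_add:
  "homogeneous_polynomial k f \<Longrightarrow> homogeneous_polynomial k g \<Longrightarrow>
    homogeneous_polynomial k (\<lambda>x. f x + g x)"
  by (auto simp: homogeneous_polynomial_def algebra_simps)

lemma homogeneous_polynomial_diff:
  "homogeneous_polynomial k f \<Longrightarrow> homogeneous_polynomial k g \<Longrightarrow>
    homogeneous_polynomial k (\<lambda>x. f x - g x)"
  by (auto simp: homogeneous_polynomial_def algebra_simps)

lemma homogeneous_polynomial_sum:
  "finite I \<Longrightarrow> (\<And>i. i \<in> I \<Longrightarrow> homogeneous_polynomial k (f i)) \<Longrightarrow>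
    homogeneous_polynomial k (\<lambda>x. \<Sum>i\<in>I. f i x)"
  by (auto simp: homogeneous_polynomial_def scaleR_sum_right intro: sum.cong)

lemma homogeneous_polynomial_cvec: "homogeneous_polynomial 1 cvec"
  using bounded_linear_cvec
  by (auto simp: homogeneous_polynomial_def intro: polynomial_function_bounded_linear linear_simps(5))

lemma homogeneous_polynomial_norm_power:
  "even n \<Longrightarrow> homogeneous_polynomial n (\<lambda>x :: 'a::euclidean_space. norm x ^ n)"
  by (simp add: homogeneous_polynomial_def polynomial_function_norm_power power_mult_distrib power_even_abs)

section \<open>Evaluation of the left and right Dirac operators\<close>

lemma partial_deriv_eqI:
  assumes "(f has_derivative f') (at x)"
  shows "partial_deriv j f x = f' (axis j 1)"
proof -
  have "(f has_derivative f') (at (x + 0 *\<^sub>R axis j 1))"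
    using assms by simp
  moreover have "((\<lambda>t. x + t *\<^sub>R axis j 1) has_derivative (\<lambda>t. t *\<^sub>R axis j 1)) (at (0::real))"
    by (rule derivative_eq_intros refl | simp)+
  ultimately have "((\<lambda>t. f (x + t *\<^sub>R axis j 1)) has_derivative (\<lambda>t. f' (t *\<^sub>R axis j 1))) (at 0)"
    by (rule has_derivative_compose [rotated])
  then have "((\<lambda>t. f (x + t *\<^sub>R axis j 1)) has_vector_derivative f' (axis j 1)) (at 0)"
    using linear_scale [OF has_derivative_linear [OF assms]] by (simp add: has_vector_derivative_def)
  then show ?thesis
    unfolding partial_deriv_def by (rule vector_derivative_at)
qed

lemma dirac_left_eqI:
  "(f has_derivative f') (at x) \<Longrightarrow> dirac_left f x = (\<Sum>j\<in>UNIV. e_gen j * f' (axis j 1))"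
  unfolding dirac_left_def by (simp add: partial_deriv_eqI)

lemma dirac_right_eqI:
  "(f has_derivative f') (at x) \<Longrightarrow> dirac_right f x = (\<Sum>j\<in>UNIV. f' (axis j 1) * e_gen j)"
  unfolding dirac_right_def by (simp add: partial_deriv_eqI)

lemma dirac_zero [simp]: "dirac_left (\<lambda>x. 0) x = 0" "dirac_right (\<lambda>x. 0) x = 0"
  by (simp_all add: dirac_left_eqI [OF has_derivative_const] dirac_right_eqI [OF has_derivative_const])

lemma polynomial_function_dirac_left:
  fixes f :: "real ^ 'm::{finite,linorder} \<Rightarrow> 'm clifford"
  assumes "polynomial_function f"
  shows "polynomial_function (dirac_left f)"
proof -
  have "dirac_left f = (\<lambda>x. \<Sum>j\<in>UNIV. e_gen j * dir_deriv (axis j 1) f x)"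
    by (intro ext dirac_left_eqI has_derivative_dir_deriv assms)
  then show ?thesis
    by (simp add: polynomial_function_sum polynomial_function_clifford_mult
        polynomial_function_dir_deriv assms)
qed

lemma dirac_sum:
  fixes f :: "'i \<Rightarrow> real ^ 'm::{finite,linorder} \<Rightarrow> 'm clifford"
  assumes "\<And>i. i \<in> I \<Longrightarrow> polynomial_function (f i)"
  shows "dirac_left (\<lambda>x. \<Sum>i\<in>I. c i *\<^sub>R f i x) x = (\<Sum>i\<in>I. c i *\<^sub>R dirac_left (f i) x)"
    and "dirac_right (\<lambda>x. \<Sum>i\<in>I. c i *\<^sub>R f i x) x = (\<Sum>i\<in>I. c i *\<^sub>R dirac_right (f i) x)"
proof -
  have *: "((\<lambda>x. \<Sum>i\<in>I. c i *\<^sub>R f i x) has_derivative (\<lambda>h. \<Sum>i\<in>I. c i *\<^sub>R dir_deriv h (f i) x)) (at x)"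
    by (intro has_derivative_sum has_derivative_scaleR_right has_derivative_dir_deriv assms)
  have f: "dirac_left (f i) x = (\<Sum>j\<in>UNIV. e_gen j * dir_deriv (axis j 1) (f i) x)"
    "dirac_right (f i) x = (\<Sum>j\<in>UNIV. dir_deriv (axis j 1) (f i) x * e_gen j)" if "i \<in> I" for i
    using that by (auto intro!: dirac_left_eqI dirac_right_eqI has_derivative_dir_deriv assms)
  show "dirac_left (\<lambda>x. \<Sum>i\<in>I. c i *\<^sub>R f i x) x = (\<Sum>i\<in>I. c i *\<^sub>R dirac_left (f i) x)"
    unfolding dirac_left_eqI [OF *] by (simp add: f sum_distrib_left scaleR_sum_right) (rule sum.swap)
  show "dirac_right (\<lambda>x. \<Sum>i\<in>I. c i *\<^sub>R f i x) x = (\<Sum>i\<in>I. c i *\<^sub>R dirac_right (f i) x)"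
    unfolding dirac_right_eqI [OF *] by (simp add: f sum_distrib_right scaleR_sum_right) (rule sum.swap)
qed

lemma dirac_scaleR:
  fixes f :: "real ^ 'm::{finite,linorder} \<Rightarrow> 'm clifford"
  assumes "polynomial_function f"
  shows "dirac_left (\<lambda>x. c *\<^sub>R f x) x = c *\<^sub>R dirac_left f x"
    and "dirac_right (\<lambda>x. c *\<^sub>R f x) x = c *\<^sub>R dirac_right f x"
  using dirac_sum [of "{()}" "\<lambda>_. f" "\<lambda>_. c"] assms by simp_all

lemma dirac_left_add:
  fixes f :: "real ^ 'm::{finite,linorder} \<Rightarrow> 'm clifford"
  assumes "polynomial_function f" "polynomial_function g"
  shows "dirac_left (\<lambda>x. f x + g x) x = dirac_left f x + dirac_left g x"
  using dirac_sum(1) [of "{False, True}" "case_bool f g" "\<lambda>_. 1" x] assms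
  by (simp add: add.commute split: bool.split)

text \<open>Reversion exchanges left and right multiplication by generators, so statements on the
  right operator can be reduced to the left one.\<close>

lemma dirac_right_reversion:
  fixes f :: "real ^ 'm::{finite,linorder} \<Rightarrow> 'm clifford"
  assumes "polynomial_function f"
  shows "dirac_right f x = reversion (dirac_left (\<lambda>x. reversion (f x)) x)"
proof -
  have "bounded_linear (reversion :: 'm clifford \<Rightarrow> _)"
    using linear_reversion by (simp add: linear_conv_bounded_linear)
  then have "((\<lambda>x. reversion (f x)) has_derivative (\<lambda>h. reversion (dir_deriv h f x))) (at x)"
    using has_derivative_dir_deriv [OF assms] by (rule bounded_linear.has_derivative)
  then show ?thesis
    by (simp add: dirac_left_eqI dirac_right_eqI [OF has_derivative_dir_deriv [OF assms]]
        linear_sum [OF linear_reversion] reversion_e_gen_mult)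
qed

lemma cvec_axis: "cvec (axis j 1) = (e_gen j :: 'm::{finite,linorder} clifford)"
proof -
  have "cvec (axis j 1) = (\<Sum>i\<in>UNIV. if i = j then e_gen i else (0 :: 'm clifford))"
    unfolding cvec_def by (rule sum.cong) (auto simp: axis_def)
  then show ?thesis
    by simp
qed

text \<open>Differentiating \<open>cvec x\<close> gives \<open>- m g\<close>, since each
  \<open>e_gen j\<close> squares to \<open>- 1\<close>. In the other part of the product rule
  \<open>e_gen j\<close> is moved past \<open>cvec x\<close>, which leaves \<open>- cvec x\<close>
  times the Dirac derivative and \<open>- 2\<close> times the Euler operator, hence
  \<open>- 2 k g\<close>.\<close>

lemma dirac_left_cvec_mult:
  fixes g :: "real ^ 'm::{finite,linorder} \<Rightarrow> 'm clifford"
  assumes "homogeneous_polynomial k g"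
  shows "dirac_left (\<lambda>x. cvec x * g x) x =
    - (real CARD('m) + 2 * real k) *\<^sub>R g x - cvec x * dirac_left g x"
proof -
  have g: "(g has_derivative (\<lambda>h. dir_deriv h g x)) (at x)"
    using assms by (simp add: homogeneous_polynomial_def has_derivative_dir_deriv)
  have "((\<lambda>x. cvec x * g x) has_derivative (\<lambda>h. cvec x * dir_deriv h g x + cvec h * g x)) (at x)"
    by (rule bounded_bilinear.FDERIV [OF bounded_bilinear_clifford_mult
          bounded_linear_imp_has_derivative [OF bounded_linear_cvec] g])
  then have "dirac_left (\<lambda>x. cvec x * g x) x =
      (\<Sum>j\<in>UNIV. e_gen j * cvec x * dir_deriv (axis j 1) g x) +
      (\<Sum>j\<in>UNIV. e_gen j * cvec (axis j 1) * g x)"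
    by (simp add: dirac_left_eqI distrib_left sum.distrib mult.assoc)
  also have "(\<Sum>j\<in>UNIV. e_gen j * cvec (axis j 1) * g x) = - real CARD('m) *\<^sub>R g x"
    by (simp add: cvec_axis scaleR_conv_of_real)
  also have "(\<Sum>j\<in>UNIV. e_gen j * cvec x * dir_deriv (axis j 1) g x) =
      - (cvec x * (\<Sum>j\<in>UNIV. e_gen j * dir_deriv (axis j 1) g x)) -
      2 *\<^sub>R (\<Sum>j\<in>UNIV. (x $ j) *\<^sub>R dir_deriv (axis j 1) g x)"
    by (simp add: e_gen_mult_cvec sum_distrib_left sum_subtractf sum_negf left_diff_distrib
        mult.assoc scaleR_sum_right)
  also have "(\<Sum>j\<in>UNIV. (x $ j) *\<^sub>R dir_deriv (axis j 1) g x) = dir_deriv x g x"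
  proof -
    have "x = (\<Sum>j\<in>UNIV. (x $ j) *\<^sub>R axis j 1)"
      using basis_expansion [of x] by (simp add: scalar_mult_eq_scaleR)
    then have "dir_deriv x g x = dir_deriv (\<Sum>j\<in>UNIV. (x $ j) *\<^sub>R axis j 1) g x"
      by simp
    also have "\<dots> = (\<Sum>j\<in>UNIV. (x $ j) *\<^sub>R dir_deriv (axis j 1) g x)"
      by (simp add: linear_sum [OF has_derivative_linear [OF g]]
          linear_scale [OF has_derivative_linear [OF g]])
    finally show ?thesis ..
  qed
  also have "dir_deriv x g x = real k *\<^sub>R g x"
    using assms by (rule homogeneous_polynomial_euler)
  finally show ?thesis
    by (simp add: dirac_left_eqI [OF g] algebra_simps)
qed

text \<open>Differentiating the factor \<open>cvec x\<close> leaves \<open>g\<close> between two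
  equal generators, and the sum of these conjugations acts on \<open>l\<close>-vectors as the scalar
  \<mu>.\<close>

lemma dirac_left_mult_cvec:
  fixes g :: "real ^ 'm::{finite,linorder} \<Rightarrow> 'm clifford"
  assumes "polynomial_function g" "range g \<subseteq> multivectors l"
  shows "dirac_left (\<lambda>x. g x * cvec x) x = mu CARD('m) l *\<^sub>R g x + dirac_left g x * cvec x"
proof -
  have g: "(g has_derivative (\<lambda>h. dir_deriv h g x)) (at x)"
    using assms by (simp add: has_derivative_dir_deriv)
  have "((\<lambda>x. g x * cvec x) has_derivative (\<lambda>h. g x * cvec h + dir_deriv h g x * cvec x)) (at x)"
    by (rule bounded_bilinear.FDERIV [OF bounded_bilinear_clifford_mult g
          bounded_linear_imp_has_derivative [OF bounded_linear_cvec]])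
  then have "dirac_left (\<lambda>x. g x * cvec x) x =
      (\<Sum>j\<in>UNIV. e_gen j * g x * cvec (axis j 1)) + dirac_left g x * cvec x"
    by (simp add: dirac_left_eqI dirac_left_eqI [OF g] distrib_left sum.distrib mult.assoc sum_distrib_right)
  also have "(\<Sum>j\<in>UNIV. e_gen j * g x * cvec (axis j 1)) = mu CARD('m) l *\<^sub>R g x"
    unfolding cvec_axis
    using assms by (intro sum_e_gen_conj) auto
  finally show ?thesis .
qed

text \<open>The gradient of \<open>norm x ^ n\<close> is \<open>n * norm x ^ (n - 2)\<close> times
  \<open>x\<close>. At \<open>n = 0\<close> the truncated exponent does no harm, as the coefficient
  \<open>real n\<close> vanishes.\<close>

lemma dirac_left_norm_power_scaleR:
  fixes g :: "real ^ 'm::{finite,linorder} \<Rightarrow> 'm clifford"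
  assumes "polynomial_function g" "even n"
  shows "dirac_left (\<lambda>x. norm x ^ n *\<^sub>R g x) x =
    (real n * norm x ^ (n - 2)) *\<^sub>R (cvec x * g x) + norm x ^ n *\<^sub>R dirac_left g x"
proof -
  obtain k where n: "n = 2 * k"
    using assms(2) by blast
  have g: "(g has_derivative (\<lambda>h. dir_deriv h g x)) (at x)"
    using assms by (simp add: has_derivative_dir_deriv)
  have "n - 2 = 2 * (k - 1)"
    using n by simp
  then have "((\<lambda>x. norm x ^ n) has_derivative (\<lambda>h. real n * norm x ^ (n - 2) * (x \<bullet> h))) (at x)"
    unfolding n by (simp only: norm_power_even)
      (rule derivative_eq_intros refl | simp add: inner_commute mult_ac)+
  then have "((\<lambda>x. norm x ^ n *\<^sub>R g x) has_derivative
      (\<lambda>h. norm x ^ n *\<^sub>R dir_deriv h g x + (real n * norm x ^ (n - 2) * (x \<bullet> h)) *\<^sub>R g x)) (at x)"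
    using g by (rule has_derivative_scaleR)
  then show ?thesis
    by (simp add: dirac_left_eqI dirac_left_eqI [OF g] distrib_left sum.distrib scaleR_sum_right
        cvec_def sum_distrib_right inner_axis)
qed

section \<open>The axial initial values and their Cauchy-Kowalevski extensions\<close>

text \<open>One chain holds all three families: \<open>i = 2 n\<close> with \<open>n \<ge> 1\<close>
  gives the first, \<open>i = 0\<close> the polynomial \<open>P\<close>, and
  \<open>i = 2 n + 1\<close> the third.\<close>

definition axial_initial ::
  "nat \<Rightarrow> nat \<Rightarrow> (real ^ 'm::{finite,linorder} \<Rightarrow> 'm clifford) \<Rightarrow> nat \<Rightarrow> real ^ 'm::{finite,linorder} \<Rightarrow> 'm clifford" where
  "axial_initial k l P i x =
    (if i = 0 then P x
     else if even i then alpha CARD('m) k (i div 2) l *\<^sub>R norm x ^ i *\<^sub>R P x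
       + norm x ^ (i - 2) *\<^sub>R (cvec x * P x * cvec x)
     else norm x ^ (i - 1) *\<^sub>R (cvec x * P x + P x * cvec x))"

text \<open>The value at \<open>i = 0\<close> records that \<open>P\<close> is monogenic. The case
  \<open>i = 1\<close> stands apart because the chain starts with \<open>P\<close> itself, without a
  factor \<open>alpha\<close>.\<close>

definition axial_factor :: "nat \<Rightarrow> nat \<Rightarrow> nat \<Rightarrow> nat \<Rightarrow> real" where
  "axial_factor m k l i =
    (if i = 0 then 0
     else if i = 1 then mu m l - (real m + 2 * real k)
     else if even i then - (real m + 2 * real k + real i)
     else real i - 1)"

lemma axial_initial_zero [simp]: "axial_initial k l P 0 = P"
  by (simp add: axial_initial_def fun_eq_iff)

lemma axial_initial_scaleR: "axial_initial k l (\<lambda>x. c *\<^sub>R P x) i x = c *\<^sub>R axial_initial k l P i x"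
  by (simp add: axial_initial_def algebra_simps)

text \<open>Differentiating a radial factor produces \<open>cvec x\<close> on the left; if the
  function already begins with \<open>cvec x\<close>, the square \<open>- |x|^2\<close> restores the
  exponent \<open>n\<close>.\<close>

lemma norm_power_cvec_square:
  assumes "even n"
  shows "(real n * norm x ^ (n - 2)) *\<^sub>R (cvec x * (cvec x * a)) = - (real n * norm x ^ n) *\<^sub>R a"
proof (cases "n = 0")
  case False
  with assms have "norm x ^ n = norm x ^ (n - 2) * (norm x)\<^sup>2"
    by (metis dvd_imp_le le_add_diff_inverse2 neq0_conv power_add)
  then show ?thesis
    by (simp add: mult.assoc [symmetric] cvec_square)
qed simp

context
  fixes P :: "real ^ 'm::{finite,linorder} \<Rightarrow> 'm clifford" and k l :: nat
  assumes P: "P \<in> left_monogenic_polys k" and l: "range P \<subseteq> multivectors l"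
begin

lemma homogeneous_P: "homogeneous_polynomial k P"
  and dirac_left_P: "dirac_left P x = 0"
  using P by (auto simp: left_monogenic_polys_def)

lemma homogeneous_P_cvec: "homogeneous_polynomial (Suc k) (\<lambda>x. P x * cvec x)"
  and homogeneous_cvec_P: "homogeneous_polynomial (Suc k) (\<lambda>x. cvec x * P x)"
  and homogeneous_cvec_P_cvec: "homogeneous_polynomial (Suc (Suc k)) (\<lambda>x. cvec x * P x * cvec x)"
proof -
  show "homogeneous_polynomial (Suc k) (\<lambda>x. P x * cvec x)"
    using homogeneous_polynomial_clifford_mult [OF homogeneous_P homogeneous_polynomial_cvec] by simp
  show *: "homogeneous_polynomial (Suc k) (\<lambda>x. cvec x * P x)"
    using homogeneous_polynomial_clifford_mult [OF homogeneous_polynomial_cvec homogeneous_P] by simp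
  show "homogeneous_polynomial (Suc (Suc k)) (\<lambda>x. cvec x * P x * cvec x)"
    using homogeneous_polynomial_clifford_mult [OF * homogeneous_polynomial_cvec] by simp
qed

lemma homogeneous_axial_initial: "homogeneous_polynomial (k + i) (axial_initial k l P i)"
proof (cases "even i")
  case True
  show ?thesis
  proof (cases "i = 0")
    case False
    with True have deg: "0 + (i + k) = k + i" "i - 2 + Suc (Suc k) = k + i"
      by (auto elim!: evenE)
    have "homogeneous_polynomial (0 + (i + k)) (\<lambda>x. alpha CARD('m) k (i div 2) l *\<^sub>R norm x ^ i *\<^sub>R P x)"
      using True by (intro homogeneous_polynomial_scaleR homogeneous_polynomial_const
          homogeneous_polynomial_norm_power homogeneous_P)
    moreover have "homogeneous_polynomial (i - 2 + Suc (Suc k))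
        (\<lambda>x. norm x ^ (i - 2) *\<^sub>R (cvec x * P x * cvec x))"
      using True by (intro homogeneous_polynomial_scaleR homogeneous_cvec_P_cvec
          homogeneous_polynomial_norm_power) simp
    ultimately have "homogeneous_polynomial (k + i) (\<lambda>x. alpha CARD('m) k (i div 2) l *\<^sub>R norm x ^ i *\<^sub>R P x
        + norm x ^ (i - 2) *\<^sub>R (cvec x * P x * cvec x))"
      unfolding deg by (rule homogeneous_polynomial_add)
    moreover have "axial_initial k l P i = (\<lambda>x. alpha CARD('m) k (i div 2) l *\<^sub>R norm x ^ i *\<^sub>R P x
        + norm x ^ (i - 2) *\<^sub>R (cvec x * P x * cvec x))"
      using True False by (simp add: axial_initial_def fun_eq_iff)
    ultimately show ?thesis
      by simp
  qed (simp add: homogeneous_P)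
next
  case False
  then have "homogeneous_polynomial (i - 1 + Suc k)
      (\<lambda>x. norm x ^ (i - 1) *\<^sub>R (cvec x * P x + P x * cvec x))"
    by (intro homogeneous_polynomial_scaleR homogeneous_polynomial_add homogeneous_cvec_P
        homogeneous_P_cvec homogeneous_polynomial_norm_power) simp
  moreover have "i - 1 + Suc k = k + i"
    using False by (cases i) auto
  moreover have "axial_initial k l P i = (\<lambda>x. norm x ^ (i - 1) *\<^sub>R (cvec x * P x + P x * cvec x))"
    using False by (auto simp: axial_initial_def fun_eq_iff)
  ultimately show ?thesis
    by (simp add: add.commute)
qed

lemma polynomial_axial_initial: "polynomial_function (axial_initial k l P i)"
  using homogeneous_axial_initial by (simp add: homogeneous_polynomial_def)

lemma dirac_left_cvec_P: "dirac_left (\<lambda>x. cvec x * P x) x = - (real CARD('m) + 2 * real k) *\<^sub>R P x"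
  by (simp add: dirac_left_cvec_mult [OF homogeneous_P] dirac_left_P)

lemma dirac_left_P_cvec: "dirac_left (\<lambda>x. P x * cvec x) x = mu CARD('m) l *\<^sub>R P x"
  using homogeneous_P
  by (simp add: dirac_left_mult_cvec [OF _ l] dirac_left_P homogeneous_polynomial_def)

text \<open>\<open>P x * cvec x\<close> has degree \<open>k + 1\<close>, which accounts for the
  extra 2; the term in \<mu> comes from its Dirac derivative.\<close>

lemma dirac_left_cvec_P_cvec: "dirac_left (\<lambda>x. cvec x * P x * cvec x) x =
    - (real CARD('m) + 2 * real k + 2) *\<^sub>R (P x * cvec x) - mu CARD('m) l *\<^sub>R (cvec x * P x)"
  by (simp add: dirac_left_cvec_mult [OF homogeneous_P_cvec] dirac_left_P_cvec mult.assoc algebra_simps)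

lemma polynomial_P: "polynomial_function P"
    "polynomial_function (\<lambda>x. cvec x * P x)" "polynomial_function (\<lambda>x. P x * cvec x)"
    "polynomial_function (\<lambda>x. cvec x * P x * cvec x)"
  using homogeneous_P homogeneous_P_cvec homogeneous_cvec_P homogeneous_cvec_P_cvec
  by (auto simp: homogeneous_polynomial_def)

text \<open>For even positive \<open>i\<close> the derivative combines \<open>cvec x * P x\<close>
  and \<open>P x * cvec x\<close>, and \<open>alpha\<close> is exactly the coefficient that makes
  them occur equally. For odd \<open>i \<ge> 3\<close> the same identity for \<open>alpha\<close>
  allows the common factor \<open>i - 1\<close> to be taken out.\<close>

lemma dirac_left_axial_initial:
  "dirac_left (axial_initial k l P i) x =
    axial_factor CARD('m) k l i *\<^sub>R axial_initial k l P (i - 1) x"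
proof (cases "even i")
  case True
  show ?thesis
  proof (cases "i = 0")
    case True
    then show ?thesis
      by (simp add: dirac_left_P axial_factor_def)
  next
    case False
    with True obtain n where "i = 2 * n" "n \<noteq> 0"
      by (auto elim!: evenE)
    then have "i = Suc (Suc (2 * (n - 1)))"
      by simp
    then obtain j where j: "i = Suc (Suc j)" "even j"
      by simp
    define a where "a = alpha CARD('m) k (i div 2) l"
    \<comment> \<open>The balancing condition: \<open>a * real i\<close> minus \<mu> is the
      coefficient that \<open>P x * cvec x\<close> receives below.\<close>
    have a: "a * real i = mu CARD('m) l - (real CARD('m) + 2 * real k + real i)"
      using True False by (auto simp: a_def alpha_def field_simps elim!: evenE)
    have "axial_initial k l P i =
        (\<lambda>x. a *\<^sub>R (norm x ^ i *\<^sub>R P x) + norm x ^ j *\<^sub>R (cvec x * P x * cvec x))"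
      using j by (simp add: axial_initial_def fun_eq_iff a_def)
    then have "dirac_left (axial_initial k l P i) x =
        a *\<^sub>R dirac_left (\<lambda>x. norm x ^ i *\<^sub>R P x) x
        + dirac_left (\<lambda>x. norm x ^ j *\<^sub>R (cvec x * P x * cvec x)) x"
      using True j(2)
      by (simp only: dirac_left_add dirac_scaleR polynomial_P polynomial_function_mult
          polynomial_function_cmul polynomial_function_norm_power)
    also have "dirac_left (\<lambda>x. norm x ^ i *\<^sub>R P x) x = (real i * norm x ^ j) *\<^sub>R (cvec x * P x)"
      using dirac_left_norm_power_scaleR [OF polynomial_P(1) True] by (simp add: dirac_left_P j(1))
    also have "dirac_left (\<lambda>x. norm x ^ j *\<^sub>R (cvec x * P x * cvec x)) x =
        - (real j * norm x ^ j) *\<^sub>R (P x * cvec x) + norm x ^ j *\<^sub>R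
        (- (real CARD('m) + 2 * real k + 2) *\<^sub>R (P x * cvec x) - mu CARD('m) l *\<^sub>R (cvec x * P x))"
      using norm_power_cvec_square [OF j(2), of x "P x * cvec x"]
      unfolding dirac_left_norm_power_scaleR [OF polynomial_P(4) j(2)] dirac_left_cvec_P_cvec
      by (simp only: mult.assoc)
    also have "a *\<^sub>R (real i * norm x ^ j) *\<^sub>R (cvec x * P x) + \<dots> =
        (norm x ^ j * (a * real i - mu CARD('m) l)) *\<^sub>R (cvec x * P x)
        + (norm x ^ j * - (real j + (real CARD('m) + 2 * real k + 2))) *\<^sub>R (P x * cvec x)"
      by (simp add: algebra_simps)
    also have "\<dots> = - (real CARD('m) + 2 * real k + real i) *\<^sub>R norm x ^ j *\<^sub>R
        (cvec x * P x + P x * cvec x)"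
      unfolding a by (simp add: j algebra_simps)
    also have "norm x ^ j *\<^sub>R (cvec x * P x + P x * cvec x) = axial_initial k l P (i - 1) x"
      using j by (simp add: axial_initial_def)
    also have "- (real CARD('m) + 2 * real k + real i) = axial_factor CARD('m) k l i"
      using True False by (auto simp: axial_factor_def)
    finally show ?thesis .
  qed
next
  case False
  then obtain j where j: "i = Suc j" "even j"
    by (cases i) auto
  have "axial_initial k l P i = (\<lambda>x. norm x ^ j *\<^sub>R (cvec x * P x + P x * cvec x))"
    using j by (simp add: axial_initial_def fun_eq_iff)
  then have "dirac_left (axial_initial k l P i) x =
      (real j * norm x ^ (j - 2)) *\<^sub>R (cvec x * (cvec x * P x)) +
      (real j * norm x ^ (j - 2)) *\<^sub>R (cvec x * P x * cvec x) +
      norm x ^ j *\<^sub>R (dirac_left (\<lambda>x. cvec x * P x) x + dirac_left (\<lambda>x. P x * cvec x) x)"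
    using dirac_left_norm_power_scaleR [OF polynomial_function_add [OF polynomial_P(2,3)] j(2)]
    by (simp only: dirac_left_add [OF polynomial_P(2,3)])
      (simp add: distrib_left scaleR_add_right mult.assoc)
  also have "\<dots> = norm x ^ j *\<^sub>R (mu CARD('m) l - (real CARD('m) + 2 * real k + real j)) *\<^sub>R P x
      + (real j * norm x ^ (j - 2)) *\<^sub>R (cvec x * P x * cvec x)"
    unfolding norm_power_cvec_square [OF j(2)] dirac_left_cvec_P dirac_left_P_cvec
    by (simp add: algebra_simps)
  \<comment> \<open>At \<open>j = 0\<close> the predecessor is \<open>P\<close> and the special
    value of \<open>axial_factor\<close> applies; otherwise \<open>real j\<close> times
    \<open>alpha\<close> reproduces the coefficient of \<open>P\<close>.\<close>
  also have "\<dots> = axial_factor CARD('m) k l i *\<^sub>R axial_initial k l P j x"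
  proof (cases "j = 0")
    case True
    then show ?thesis
      by (simp add: axial_factor_def j)
  next
    case False
    have "real j * alpha CARD('m) k (j div 2) l = mu CARD('m) l - (real CARD('m) + 2 * real k + real j)"
      using False j(2) by (auto simp: alpha_def field_simps elim!: evenE)
    with False j show ?thesis
      by (simp add: axial_factor_def axial_initial_def scaleR_add_right mult_ac)
  qed
  finally show ?thesis
    using j by simp
qed

text \<open>Reversion exchanges \<open>cvec x * P x\<close> and \<open>P x * cvec x\<close> up to
  the sign of \<open>P\<close>, so every member of the chain is multiplied by that same sign. It
  occurs once inside and once outside the left operator and squares to 1.\<close>

lemma dirac_right_axial_initial:
  "dirac_right (axial_initial k l P i) x = dirac_left (axial_initial k l P i) x"
proof -
  have rev: "reversion (axial_initial k l P i x) = reversion_sign l *\<^sub>R axial_initial k l P i x" for i x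
  proof -
    have "reversion (P x) = reversion_sign l *\<^sub>R P x"
      using l by (intro reversion_multivector) auto
    then show ?thesis
      by (simp add: axial_initial_def linear_scale [OF linear_reversion] linear_add [OF linear_reversion]
          reversion_cvec_mult reversion_mult_cvec algebra_simps)
  qed
  have "dirac_right (axial_initial k l P i) x =
      reversion (reversion_sign l *\<^sub>R dirac_left (axial_initial k l P i) x)"
    by (simp add: dirac_right_reversion polynomial_axial_initial rev dirac_scaleR)
  also have "\<dots> = dirac_left (axial_initial k l P i) x"
    by (simp add: dirac_left_axial_initial linear_scale [OF linear_reversion] rev
        reversion_sign_square mult.assoc [symmetric] mult.left_commute [of _ "reversion_sign l"])
  finally show ?thesis .
qed

text \<open>Each application moves one step down the chain. Since \<open>i - n\<close> is truncated
  at 0, the vanishing for \<open>n > i\<close> is recorded separately by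
  \<open>c = 0\<close>.\<close>

lemma funpow_dirac_left_axial_initial:
  "\<exists>c. (dirac_left ^^ n) (axial_initial k l P i) = (\<lambda>x. c *\<^sub>R axial_initial k l P (i - n) x) \<and>
    (i < n \<longrightarrow> c = 0)"
proof (induction n)
  case 0
  show ?case
    by (intro exI [of _ 1]) simp
next
  case (Suc n)
  then obtain c where c: "(dirac_left ^^ n) (axial_initial k l P i) =
      (\<lambda>x. c *\<^sub>R axial_initial k l P (i - n) x)" "i < n \<Longrightarrow> c = 0"
    by auto
  have "(dirac_left ^^ Suc n) (axial_initial k l P i) =
      (\<lambda>x. (c * axial_factor CARD('m) k l (i - n)) *\<^sub>R axial_initial k l P (i - Suc n) x)"
    by (simp add: c fun_eq_iff dirac_scaleR polynomial_axial_initial dirac_left_axial_initial)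
  \<comment> \<open>Here \<open>i - n = 0\<close>, and the factor at 0 is 0.\<close>
  moreover have "c * axial_factor CARD('m) k l (i - n) = 0" if "i < Suc n"
    using that by (simp add: axial_factor_def)
  ultimately show ?case
    by blast
qed

end

section \<open>Cauchy-Kowalevski extensions of polynomials with terminating Dirac iterates\<close>

lemma polynomial_funpow_dirac_left:
  "polynomial_function g \<Longrightarrow> polynomial_function ((dirac_left ^^ n) g)"
  by (induction n) (simp_all add: polynomial_function_dirac_left)

context
  fixes g :: "real ^ 'm::{finite,linorder} \<Rightarrow> 'm clifford" and N :: nat
  assumes g: "polynomial_function g" and N: "\<And>n. N \<le> n \<Longrightarrow> (dirac_left ^^ n) g = (\<lambda>x. 0)"
begin

text \<open>The free bound \<open>M\<close> permits extra zero terms, which the index shift in the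
  time derivative uses.\<close>

lemma CK_eq_sum:
  "N \<le> M \<Longrightarrow> CK g (x0, x) = (\<Sum>n<M. ((- x0) ^ n / fact n) *\<^sub>R (dirac_left ^^ n) g x)"
  unfolding CK_def by (simp, rule suminf_finite) (auto simp: N)

lemma CK_dirac_left_eq_sum:
  "CK (dirac_left g) (x0, x) = (\<Sum>n<N. ((- x0) ^ n / fact n) *\<^sub>R (dirac_left ^^ Suc n) g x)"
proof -
  have "(dirac_left ^^ n) (dirac_left g) = (dirac_left ^^ Suc n) g" for n
    by (simp add: funpow_swap1)
  then show ?thesis
    unfolding CK_def by (simp del: funpow.simps, intro suminf_finite) (auto simp: N simp del: funpow.simps)
qed

lemma polynomial_CK: "polynomial_function (CK g)"
proof -
  have "CK g = (\<lambda>p. \<Sum>n<N. ((- fst p) ^ n / fact n) *\<^sub>R (dirac_left ^^ n) g (snd p))"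
    using CK_eq_sum by (auto simp: fun_eq_iff)
  moreover have "polynomial_function (\<lambda>p :: real \<times> (real ^ 'm::{finite,linorder}). (dirac_left ^^ n) g (snd p))" for n
    using polynomial_function_compose [OF polynomial_function_bounded_linear [OF bounded_linear_snd]
        polynomial_funpow_dirac_left [OF g]] by (simp add: o_def)
  moreover have "polynomial_function (\<lambda>p :: real \<times> (real ^ 'm::{finite,linorder}). (- fst p) ^ n / fact n)" for n
    unfolding real_polynomial_function_eq [symmetric]
    by (intro real_polynomial_function_divide real_polynomial_function_power
        real_polynomial_function_minus real_polynomial_function.intros(1) bounded_linear_fst)
  ultimately show ?thesis
    by (simp add: polynomial_function_sum polynomial_function_mult)
qed

text \<open>Termwise differentiation: the constant term drops out, and the term of index
  \<open>n + 1\<close> becomes minus the term of index \<open>n\<close> in the extension of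
  \<open>dirac_left g\<close>.\<close>

lemma CK_has_vector_derivative:
  "((\<lambda>t. CK g (t, x)) has_vector_derivative - CK (dirac_left g) (x0, x)) (at x0)"
proof -
  have "((\<lambda>t. (- t) ^ Suc n / fact (Suc n)) has_real_derivative - ((- x0) ^ n / fact n)) (at x0)" for n
    by (rule derivative_eq_intros refl | simp)+
  then have "((\<lambda>t. g x + (\<Sum>n<N. ((- t) ^ Suc n / fact (Suc n)) *\<^sub>R (dirac_left ^^ Suc n) g x))
      has_vector_derivative 0 + (\<Sum>n<N. (- ((- x0) ^ n / fact n)) *\<^sub>R (dirac_left ^^ Suc n) g x)) (at x0)"
    by (intro has_vector_derivative_add has_vector_derivative_sum has_vector_derivative_const
        bounded_linear.has_vector_derivative [OF bounded_linear_scaleR_left])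
      (simp only: has_real_derivative_iff_has_vector_derivative)
  moreover have "CK g (t, x) =
      g x + (\<Sum>n<N. ((- t) ^ Suc n / fact (Suc n)) *\<^sub>R (dirac_left ^^ Suc n) g x)" for t
    by (simp add: CK_eq_sum [of "Suc N"] sum.lessThan_Suc_shift del: sum.lessThan_Suc)
  ultimately show ?thesis
    by (simp add: CK_dirac_left_eq_sum sum_negf)
qed

lemma dirac_left_CK: "dirac_left (\<lambda>y. CK g (x0, y)) x = CK (dirac_left g) (x0, x)"
  by (simp add: CK_eq_sum [OF order_refl] CK_dirac_left_eq_sum dirac_sum polynomial_funpow_dirac_left g)

text \<open>Agreement of the two operators on all Dirac iterates makes the right derivative of the
  extension equal to the left one, \<open>CK (dirac_left g)\<close>, and the time derivative is its
  negative.\<close>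

lemma two_sided_monogenic_CK:
  assumes "\<And>n x. dirac_right ((dirac_left ^^ n) g) x = dirac_left ((dirac_left ^^ n) g) x"
  shows "two_sided_monogenic_on (CK g) UNIV"
proof -
  have "dirac_right (\<lambda>y. CK g (x0, y)) x = CK (dirac_left g) (x0, x)" for x0 x
    by (simp add: CK_eq_sum [OF order_refl] CK_dirac_left_eq_sum dirac_sum
        polynomial_funpow_dirac_left g assms)
  then show ?thesis
    by (simp add: two_sided_monogenic_on_def polynomial_function_imp_continuously_differentiable_on
        polynomial_CK dirac_left_CK vector_derivative_at [OF CK_has_vector_derivative])
qed

end

text \<open>Links the slice derivatives in the definition of two-sided monogenicity with directional
  derivatives on the product space, for which commutation is available.\<close>

lemma polynomial_slice_derivs:
  fixes f :: "real \<times> (real ^ 'm::{finite,linorder}) \<Rightarrow> 'm clifford"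
  assumes f: "polynomial_function f"
  shows "((\<lambda>t. f (t, x)) has_vector_derivative dir_deriv (1, 0) f (x0, x)) (at x0)"
    and "((\<lambda>y. f (x0, y)) has_derivative (\<lambda>h. dir_deriv (0, h) f (x0, x))) (at x)"
proof -
  have "((\<lambda>t. f ((0, x) + t *\<^sub>R (1, 0))) has_vector_derivative
      dir_deriv (1, 0) f ((0, x) + x0 *\<^sub>R (1, 0))) (at x0)"
    by (rule has_vector_derivative_dir_deriv [OF f])
  then show "((\<lambda>t. f (t, x)) has_vector_derivative dir_deriv (1, 0) f (x0, x)) (at x0)"
    by simp
  show "((\<lambda>y. f (x0, y)) has_derivative (\<lambda>h. dir_deriv (0, h) f (x0, x))) (at x)"
    by (rule has_derivative_compose [OF _ has_derivative_dir_deriv [OF f]])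
      (intro has_derivative_Pair has_derivative_const has_derivative_ident)
qed

lemma CK_scaleR:
  assumes "polynomial_function g" "\<And>n. N \<le> n \<Longrightarrow> (dirac_left ^^ n) g = (\<lambda>x. 0)"
  shows "CK (\<lambda>x. c *\<^sub>R g x) p = c *\<^sub>R CK g p"
proof -
  have *: "(dirac_left ^^ n) (\<lambda>x. c *\<^sub>R g x) = (\<lambda>x. c *\<^sub>R (dirac_left ^^ n) g x)" for n
  proof (induction n)
    case (Suc n)
    show ?case
      by (rule ext) (simp add: Suc dirac_scaleR polynomial_funpow_dirac_left [OF assms(1)])
  qed simp
  have "CK (\<lambda>x. c *\<^sub>R g x) (x0, x) = c *\<^sub>R CK g (x0, x)" for x0 x
    by (simp add: CK_eq_sum [OF _ _ order_refl, of _ N] * assms polynomial_function_cmul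
        scaleR_sum_right mult.commute)
  then show ?thesis
    by (cases p) simp
qed

section \<open>Extensions of the axial chain\<close>

definition CK_axial ::
  "nat \<Rightarrow> nat \<Rightarrow> (real ^ 'm::{finite,linorder} \<Rightarrow> 'm clifford) \<Rightarrow> nat \<Rightarrow>
    real \<times> (real ^ 'm::{finite,linorder}) \<Rightarrow> 'm clifford" where
  "CK_axial k l P i = CK (axial_initial k l P i)"

context
  fixes P :: "real ^ 'm::{finite,linorder} \<Rightarrow> 'm clifford" and k l :: nat
  assumes P: "P \<in> left_monogenic_polys k" and l: "range P \<subseteq> multivectors l"
begin

lemma funpow_dirac_left_axial_initial_eq_zero:
  "Suc i \<le> n \<Longrightarrow> (dirac_left ^^ n) (axial_initial k l P i) = (\<lambda>x. 0)"
  using funpow_dirac_left_axial_initial [OF P l, of n i] by auto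

lemmas CK_axial_rules = polynomial_axial_initial [OF P l] funpow_dirac_left_axial_initial_eq_zero

lemma polynomial_CK_axial: "polynomial_function (CK_axial k l P i)"
  unfolding CK_axial_def by (rule polynomial_CK [OF CK_axial_rules])

lemma two_sided_monogenic_CK_axial: "two_sided_monogenic_on (CK_axial k l P i) UNIV"
  unfolding CK_axial_def
proof (rule two_sided_monogenic_CK [OF CK_axial_rules])
  fix n x
  show "dirac_right ((dirac_left ^^ n) (axial_initial k l P i)) x =
      dirac_left ((dirac_left ^^ n) (axial_initial k l P i)) x"
    using funpow_dirac_left_axial_initial [OF P l, of n i]
    by (auto simp: dirac_scaleR polynomial_axial_initial [OF P l]
        dirac_right_axial_initial [OF P l])
qed

lemma CK_axial_scaleR: "CK_axial k l (\<lambda>x. c *\<^sub>R P x) i p = c *\<^sub>R CK_axial k l P i p"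
proof -
  have "axial_initial k l (\<lambda>x. c *\<^sub>R P x) i = (\<lambda>x. c *\<^sub>R axial_initial k l P i x)"
    by (simp add: fun_eq_iff axial_initial_scaleR)
  then show ?thesis
    unfolding CK_axial_def by (simp add: CK_scaleR [OF CK_axial_rules])
qed

lemma CK_axial_eq_sum:
  "CK_axial k l P i (x0, x) =
    (\<Sum>n\<le>i. ((- x0) ^ n / fact n) *\<^sub>R (dirac_left ^^ n) (axial_initial k l P i) x)"
  unfolding CK_axial_def lessThan_Suc_atMost [symmetric]
  by (rule CK_eq_sum [OF CK_axial_rules order_refl])

lemma CK_axial_zero: "CK_axial k l P 0 = (\<lambda>(x0, x). P x)"
  by (auto simp: fun_eq_iff CK_axial_eq_sum)

lemma dir_deriv_CK_axial:
  "dir_deriv (1, 0) (CK_axial k l P (Suc i)) p =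
    - (axial_factor CARD('m) k l (Suc i) *\<^sub>R CK_axial k l P i p)"
proof (cases p)
  case (Pair x0 x)
  have "dir_deriv (1, 0) (CK_axial k l P (Suc i)) (x0, x) =
      - CK (dirac_left (axial_initial k l P (Suc i))) (x0, x)"
    using polynomial_slice_derivs(1) [OF polynomial_CK_axial]
    unfolding CK_axial_def
    by (rule vector_derivative_unique_at) (rule CK_has_vector_derivative [OF CK_axial_rules])
  also have "dirac_left (axial_initial k l P (Suc i)) =
      (\<lambda>x. axial_factor CARD('m) k l (Suc i) *\<^sub>R axial_initial k l P i x)"
    by (simp add: fun_eq_iff dirac_left_axial_initial [OF P l])
  finally show ?thesis
    by (simp add: Pair CK_scaleR [OF CK_axial_rules] CK_axial_def)
qed

text \<open>Signs, factorials and products of factors are absorbed in \<open>c\<close>; homogeneity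
  and the axial form are read off from this shape.\<close>

lemma CK_axial_expansion:
  "\<exists>c. \<forall>x0 x. CK_axial k l P i (x0, x) =
    (\<Sum>n\<le>i. (c n * x0 ^ n) *\<^sub>R axial_initial k l P (i - n) x)"
proof -
  have "\<forall>n. \<exists>c. (dirac_left ^^ n) (axial_initial k l P i) = (\<lambda>x. c *\<^sub>R axial_initial k l P (i - n) x)"
    using funpow_dirac_left_axial_initial [OF P l] by blast
  from choice [OF this] obtain c where c: "\<And>n. (dirac_left ^^ n) (axial_initial k l P i) =
      (\<lambda>x. c n *\<^sub>R axial_initial k l P (i - n) x)"
    by blast
  define c' where "c' n = (- 1) ^ n / fact n * c n" for n
  have "((- x0) ^ n / fact n) * c n = c' n * x0 ^ n" for n and x0 :: real
    by (simp add: c'_def power_minus [of x0])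
  then have "\<forall>x0 x. CK_axial k l P i (x0, x) =
      (\<Sum>n\<le>i. (c' n * x0 ^ n) *\<^sub>R axial_initial k l P (i - n) x)"
    by (simp only: CK_axial_eq_sum c scaleR_scaleR) simp
  then show ?thesis
    by (rule exI [of _ c'])
qed

lemma homogeneous_CK_axial: "homogeneous_polynomial (k + i) (CK_axial k l P i)"
  unfolding homogeneous_polynomial_def
proof (intro conjI allI polynomial_CK_axial)
  fix t :: real and p :: "real \<times> (real ^ 'm::{finite,linorder})"
  obtain c where c: "\<And>x0 x. CK_axial k l P i (x0, x) =
      (\<Sum>n\<le>i. (c n * x0 ^ n) *\<^sub>R axial_initial k l P (i - n) x)"
    using CK_axial_expansion [of i] by blast
  have "t ^ n * t ^ (k + (i - n)) = t ^ (k + i)" if "n \<le> i" for n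
    using that by (simp flip: power_add)
  moreover have "axial_initial k l P j (t *\<^sub>R x) = t ^ (k + j) *\<^sub>R axial_initial k l P j x" for j x
    using homogeneous_axial_initial [OF P l, of j] by (simp add: homogeneous_polynomial_def)
  ultimately show "CK_axial k l P i (t *\<^sub>R p) = t ^ (k + i) *\<^sub>R CK_axial k l P i p"
    by (cases p) (auto simp: c scaleR_sum_right power_mult_distrib mult_ac intro!: sum.cong)
qed

text \<open>Every member of the chain combines \<open>P x\<close>, its one-sided products and its
  two-sided product with \<open>cvec x\<close>, with coefficients polynomial in
  \<open>norm x\<close>. The extension therefore has coefficients polynomial in \<open>x0\<close>
  and \<open>norm x\<close>. The domain corresponds to \<open>x \<noteq> 0\<close>.\<close>

lemma axial_two_sided_monogenic_CK_axial:
  assumes "l \<le> CARD('m)"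
  shows "axial_two_sided_monogenic_on (CK_axial k l P i) {(x1, x2). x2 > 0}"
proof -
  let ?W = "{(x1, x2). x2 > 0} :: (real \<times> real) set"
  have W: "open ?W"
  proof -
    have "?W = UNIV \<times> {0<..}"
      by auto
    then show ?thesis
      by (simp add: open_Times)
  qed
  have "{(x0 :: real, x :: real ^ 'm::{finite,linorder}). (x0, norm x) \<in> ?W} = UNIV \<times> (- {0})"
    by auto
  then have U: "open {(x0 :: real, x :: real ^ 'm::{finite,linorder}). (x0, norm x) \<in> ?W}"
    by (simp only:) (intro open_Times open_UNIV open_Compl closed_singleton)
  have mono: "two_sided_monogenic_on (CK_axial k l P i) {(x0, x). (x0, norm x) \<in> ?W}"
    using two_sided_monogenic_CK_axial [of i] U
    by (auto simp: two_sided_monogenic_on_def polynomial_CK_axial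
        polynomial_function_imp_continuously_differentiable_on)
  obtain c where c: "\<And>x0 x. CK_axial k l P i (x0, x) =
      (\<Sum>n\<le>i. (c n * x0 ^ n) *\<^sub>R axial_initial k l P (i - n) x)"
    using CK_axial_expansion [of i] by blast
  \<comment> \<open>The radial coefficients of the chain: \<open>a\<close> goes with
    \<open>P x\<close>, \<open>b\<close> serves both one-sided products, and \<open>d\<close> goes
    with the two-sided product.\<close>
  define a b d :: "nat \<Rightarrow> real \<Rightarrow> real" where
    "a = (\<lambda>j r. if j = 0 then 1 else if even j then alpha CARD('m) k (j div 2) l * r ^ j else 0)" and
    "b = (\<lambda>j r. if even j then 0 else r ^ (j - 1))" and
    "d = (\<lambda>j r. if j = 0 then 0 else if even j then r ^ (j - 2) else 0)"
  have expand: "axial_initial k l P j x = a j (norm x) *\<^sub>R P x + b j (norm x) *\<^sub>R (cvec x * P x)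
      + b j (norm x) *\<^sub>R (P x * cvec x) + d j (norm x) *\<^sub>R (cvec x * P x * cvec x)" for j x
    by (auto simp: axial_initial_def a_def b_def d_def algebra_simps)
  define S :: "(nat \<Rightarrow> real \<Rightarrow> real) \<Rightarrow> real \<times> real \<Rightarrow> real" where
    "S h p = (\<Sum>n\<le>i. c n * fst p ^ n * h (i - n) (snd p))" for h p
  have S: "continuously_differentiable_on (S h) ?W"
    if "\<And>j. polynomial_function (h j)" for h
  proof -
    have "polynomial_function (\<lambda>p :: real \<times> real. h j (snd p))" for j
      using polynomial_function_compose [OF polynomial_function_bounded_linear [OF bounded_linear_snd] that]
      by (simp add: o_def)
    then have "polynomial_function (S h)"
      unfolding S_def real_polynomial_function_eq [symmetric]
      by (intro real_polynomial_function_sum real_polynomial_function.intros(4)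
          real_polynomial_function_power)
        (auto intro: real_polynomial_function.intros(1) bounded_linear_fst)
    then show ?thesis
      by (rule polynomial_function_imp_continuously_differentiable_on)
  qed
  have power: "polynomial_function (\<lambda>r :: real. r ^ n)" for n
    unfolding real_polynomial_function_eq [symmetric]
    by (intro real_polynomial_function_power real_polynomial_function.intros(1) bounded_linear_ident)
  have poly: "polynomial_function (a j)" "polynomial_function (b j)" "polynomial_function (d j)" for j
    using power polynomial_function_cmul [OF power] unfolding a_def b_def d_def
    by (cases "j = 0"; cases "even j"; simp)+
  have "CK_axial k l P i (x0, x) = S a (x0, norm x) *\<^sub>R P x + S b (x0, norm x) *\<^sub>R (cvec x * P x)
      + S b (x0, norm x) *\<^sub>R (P x * cvec x) + S d (x0, norm x) *\<^sub>R (cvec x * P x * cvec x)" for x0 x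
    by (simp add: c expand S_def scaleR_add_right sum.distrib scaleR_sum_left)
  \<comment> \<open>The primed copies name the fixed data inside quantifiers that bind the same
    letters.\<close>
  then have "\<exists>k l P (A :: real \<times> real \<Rightarrow> real) B C D.
      l \<le> CARD('m) \<and> P \<in> left_monogenic_polys k \<and> range P \<subseteq> multivectors l \<and>
      continuously_differentiable_on A ?W \<and> continuously_differentiable_on B ?W \<and>
      continuously_differentiable_on C ?W \<and> continuously_differentiable_on D ?W \<and>
      (\<forall>x0 x. (x0, norm x) \<in> ?W \<longrightarrow>
         CK_axial k' l' P' i (x0, x) = A (x0, norm x) *\<^sub>R P x + B (x0, norm x) *\<^sub>R (cvec x * P x)
           + C (x0, norm x) *\<^sub>R (P x * cvec x) + D (x0, norm x) *\<^sub>R (cvec x * P x * cvec x))"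
    if "k' = k" "l' = l" "P' = P" for k' l' P'
    unfolding that
    by (intro exI [of _ k] exI [of _ l] exI [of _ P] exI [of _ "S a"] exI [of _ "S b"]
        exI [of _ "S b"] exI [of _ "S d"] conjI assms P l S poly allI impI)
  from this [OF refl refl refl] W mono show ?thesis
    unfolding axial_two_sided_monogenic_on_def by (intro conjI) auto
qed

end

section \<open>Two-sided monogenic polynomials\<close>

text \<open>The generalized Cauchy-Riemann operator, written with directional derivatives on the
  product space so that it can be commuted with \<open>dir_deriv\<close>.\<close>

definition cauchy_riemann_left ::
  "(real \<times> (real ^ 'm::{finite,linorder}) \<Rightarrow> 'm clifford) \<Rightarrow> real \<times> (real ^ 'm::{finite,linorder}) \<Rightarrow> 'm clifford" where
  "cauchy_riemann_left f p = dir_deriv (1, 0) f p + (\<Sum>j\<in>UNIV. e_gen j * dir_deriv (0, axis j 1) f p)"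

definition cauchy_riemann_right ::
  "(real \<times> (real ^ 'm::{finite,linorder}) \<Rightarrow> 'm clifford) \<Rightarrow> real \<times> (real ^ 'm::{finite,linorder}) \<Rightarrow> 'm clifford" where
  "cauchy_riemann_right f p = dir_deriv (1, 0) f p + (\<Sum>j\<in>UNIV. dir_deriv (0, axis j 1) f p * e_gen j)"

lemma two_sided_monogenic_on_UNIV_iff:
  fixes f :: "real \<times> (real ^ 'm::{finite,linorder}) \<Rightarrow> 'm clifford"
  assumes f: "polynomial_function f"
  shows "two_sided_monogenic_on f UNIV \<longleftrightarrow>
    (\<forall>p. cauchy_riemann_left f p = 0 \<and> cauchy_riemann_right f p = 0)"
  by (simp add: two_sided_monogenic_on_def polynomial_function_imp_continuously_differentiable_on f
      vector_derivative_at [OF polynomial_slice_derivs(1) [OF f]]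
      dirac_left_eqI [OF polynomial_slice_derivs(2) [OF f]]
      dirac_right_eqI [OF polynomial_slice_derivs(2) [OF f]]
      cauchy_riemann_left_def cauchy_riemann_right_def)

lemma two_sided_monogenic_sum:
  fixes f :: "'i \<Rightarrow> real \<times> (real ^ 'm::{finite,linorder}) \<Rightarrow> 'm clifford"
  assumes "finite I" "\<And>i. i \<in> I \<Longrightarrow> polynomial_function (f i)"
    "\<And>i. i \<in> I \<Longrightarrow> two_sided_monogenic_on (f i) UNIV"
  shows "two_sided_monogenic_on (\<lambda>p. \<Sum>i\<in>I. f i p) UNIV"
proof -
  have d: "dir_deriv v (\<lambda>p. \<Sum>i\<in>I. f i p) p = (\<Sum>i\<in>I. dir_deriv v (f i) p)" for v p
    by (rule dir_deriv_eqI) (intro has_derivative_sum has_derivative_dir_deriv assms)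
  have "cauchy_riemann_left (\<lambda>p. \<Sum>i\<in>I. f i p) p = (\<Sum>i\<in>I. cauchy_riemann_left (f i) p)" for p
    unfolding cauchy_riemann_left_def d sum.distrib sum_distrib_left by (subst sum.swap) (rule refl)
  moreover have "cauchy_riemann_right (\<lambda>p. \<Sum>i\<in>I. f i p) p = (\<Sum>i\<in>I. cauchy_riemann_right (f i) p)" for p
    unfolding cauchy_riemann_right_def d sum.distrib sum_distrib_right by (subst sum.swap) (rule refl)
  ultimately show ?thesis
    using assms by (simp add: two_sided_monogenic_on_UNIV_iff polynomial_function_sum)
qed

lemma two_sided_monogenic_diff:
  fixes f g :: "real \<times> (real ^ 'm::{finite,linorder}) \<Rightarrow> 'm clifford"
  assumes "polynomial_function f" "polynomial_function g"
    "two_sided_monogenic_on f UNIV" "two_sided_monogenic_on g UNIV"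
  shows "two_sided_monogenic_on (\<lambda>p. f p - g p) UNIV"
proof -
  have d: "dir_deriv v (\<lambda>p. f p - g p) p = dir_deriv v f p - dir_deriv v g p" for v p
    by (rule dir_deriv_eqI) (intro has_derivative_diff has_derivative_dir_deriv assms)
  have "cauchy_riemann_left (\<lambda>p. f p - g p) p = cauchy_riemann_left f p - cauchy_riemann_left g p"
    "cauchy_riemann_right (\<lambda>p. f p - g p) p = cauchy_riemann_right f p - cauchy_riemann_right g p" for p
    by (simp_all add: cauchy_riemann_left_def cauchy_riemann_right_def d right_diff_distrib
        left_diff_distrib sum_subtractf)
  then show ?thesis
    using assms by (simp add: two_sided_monogenic_on_UNIV_iff polynomial_function_diff)
qed

text \<open>The operators have constant coefficients: by symmetry of second derivatives,
  differentiating the zero function \<open>cauchy_riemann_left f\<close> in direction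
  \<open>v\<close> gives the operator applied to \<open>dir_deriv v f\<close>, and likewise on the
  right.\<close>

lemma two_sided_monogenic_dir_deriv:
  fixes f :: "real \<times> (real ^ 'm::{finite,linorder}) \<Rightarrow> 'm clifford"
  assumes f: "polynomial_function f" and "two_sided_monogenic_on f UNIV"
  shows "two_sided_monogenic_on (dir_deriv v f) UNIV"
proof -
  have d: "(dir_deriv u f has_derivative (\<lambda>h. dir_deriv u (dir_deriv h f) p)) (at p)" for u p
    using has_derivative_dir_deriv [OF polynomial_function_dir_deriv [OF f], of u p]
    by (simp only: dir_deriv_commute [OF f, of _ u])
  have "(cauchy_riemann_left f has_derivative (\<lambda>h. cauchy_riemann_left (dir_deriv h f) p)) (at p)" for p
    unfolding cauchy_riemann_left_def [abs_def]
    by (intro has_derivative_add has_derivative_sum d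
        bounded_linear.has_derivative [OF bounded_linear_clifford_mult_left])
  moreover have "(cauchy_riemann_right f has_derivative (\<lambda>h. cauchy_riemann_right (dir_deriv h f) p)) (at p)" for p
    unfolding cauchy_riemann_right_def [abs_def]
    by (intro has_derivative_add has_derivative_sum d
        bounded_linear.has_derivative [OF bounded_linear_clifford_mult_right])
  moreover have "cauchy_riemann_left f = (\<lambda>p. 0)" "cauchy_riemann_right f = (\<lambda>p. 0)"
    using assms by (simp_all add: two_sided_monogenic_on_UNIV_iff fun_eq_iff)
  ultimately have deriv: "((\<lambda>p. 0) has_derivative (\<lambda>h. cauchy_riemann_left (dir_deriv h f) p)) (at p)"
    "((\<lambda>p. 0) has_derivative (\<lambda>h. cauchy_riemann_right (dir_deriv h f) p)) (at p)" for p
    by simp_all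
  show ?thesis
    using fun_cong [OF has_derivative_unique [OF deriv(1) has_derivative_const], of v]
      fun_cong [OF has_derivative_unique [OF deriv(2) has_derivative_const], of v]
    by (simp add: two_sided_monogenic_on_UNIV_iff polynomial_function_dir_deriv f)
qed

section \<open>Grade projections and the comparison of the two Cauchy-Riemann equations\<close>

definition grade_proj :: "nat \<Rightarrow> 'm clifford \<Rightarrow> 'm::{finite,linorder} clifford" where
  "grade_proj l x = of_coords (\<lambda>A. if card A = l then coords x A else 0)"

lemma coords_grade_proj [simp]: "coords (grade_proj l x) A = (if card A = l then coords x A else 0)"
  by (simp add: grade_proj_def)

lemma linear_grade_proj: "linear (grade_proj l)"
  by (simp add: linear_iff clifford_eq_iff)

lemma sum_grade_proj:
  fixes x :: "'m::{finite,linorder} clifford"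
  shows "(\<Sum>l\<le>CARD('m). grade_proj l x) = x"
  by (simp add: clifford_eq_iff coords_sum card_mono)

text \<open>In coordinate \<open>C\<close>, indices \<open>j \<in> C\<close> collect contributions
  from grade \<open>card C - 1\<close> and the others from grade \<open>card C + 1\<close>. Passing
  from left to right multiplication changes the two groups by opposite signs.\<close>

lemma coords_sum_e_gen_mult:
  fixes a :: "'m::{finite,linorder} \<Rightarrow> 'm clifford"
  defines "w \<equiv> \<lambda>C j. blade_sign {j} (sym_diff {j} C) * coords (a j) (sym_diff {j} C)"
  shows "coords (\<Sum>j\<in>UNIV. e_gen j * a j) C = (\<Sum>j\<in>C. w C j) + (\<Sum>j\<in>- C. w C j)"
    and "coords (\<Sum>j\<in>UNIV. a j * e_gen j) C =
      (- 1) ^ card C * ((\<Sum>j\<in>- C. w C j) - (\<Sum>j\<in>C. w C j))"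
proof -
  have split: "sum h UNIV = sum h C + sum h (- C)" for h :: "'m \<Rightarrow> real"
    by (subst sum.union_disjoint [symmetric]) (auto simp: Compl_partition)
  show "coords (\<Sum>j\<in>UNIV. e_gen j * a j) C = (\<Sum>j\<in>C. w C j) + (\<Sum>j\<in>- C. w C j)"
    by (simp only: coords_sum coords_e_gen_mult w_def split)
  have "coords (a j * e_gen j) C = - ((- 1) ^ card C * w C j)" if j: "j \<in> C" for j
  proof -
    obtain D where "C = insert j D" "j \<notin> D"
      using j by (meson mk_disjoint_insert)
    moreover from this have "sym_diff {j} C = D"
      by auto
    ultimately show ?thesis
      by (simp add: w_def coords_mult_e_gen blade_sign_swap)
  qed
  moreover have "coords (a j * e_gen j) C = (- 1) ^ card C * w C j" if j: "j \<notin> C" for j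
  proof -
    have "sym_diff {j} C = insert j C"
      using j by auto
    then show ?thesis
      using j by (simp add: w_def coords_mult_e_gen blade_sign_swap)
  qed
  ultimately show "coords (\<Sum>j\<in>UNIV. a j * e_gen j) C =
      (- 1) ^ card C * ((\<Sum>j\<in>- C. w C j) - (\<Sum>j\<in>C. w C j))"
    by (simp add: coords_sum split sum_negf sum_distrib_left [symmetric] right_diff_distrib)
qed

text \<open>The left and right operators agree up to sign on the parts raising and lowering the grade,
  so both parts vanish separately.\<close>

lemma sum_e_gen_mult_grade_proj_eq_zero:
  fixes a :: "'m::{finite,linorder} \<Rightarrow> 'm clifford"
  assumes "(\<Sum>j\<in>UNIV. e_gen j * a j) = 0" "(\<Sum>j\<in>UNIV. a j * e_gen j) = 0"
  shows "(\<Sum>j\<in>UNIV. e_gen j * grade_proj l (a j)) = 0"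
  unfolding clifford_eq_iff
proof
  fix C :: "'m set"
  define w where "w j = blade_sign {j} (sym_diff {j} C) * coords (a j) (sym_diff {j} C)" for j
  have "coords (0 :: 'm clifford) C = sum w C + sum w (- C)"
    "coords (0 :: 'm clifford) C = (- 1) ^ card C * (sum w (- C) - sum w C)"
    using coords_sum_e_gen_mult [of a C] unfolding assms w_def .
  then have zero: "sum w C = 0" "sum w (- C) = 0"
    by auto
  \<comment> \<open>Toggling \<open>j\<close> lowers the grade of \<open>C\<close> by one, so the
    projection keeps either every term of this sum or none; both results are 0.\<close>
  have "(\<Sum>j\<in>C. blade_sign {j} (sym_diff {j} C) * coords (grade_proj l (a j)) (sym_diff {j} C)) =
      (\<Sum>j\<in>C. if card C = Suc l then w j else 0)"
  proof (rule sum.cong [OF refl])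
    fix j assume "j \<in> C"
    then obtain D where "C = insert j D" "j \<notin> D"
      by (meson mk_disjoint_insert)
    moreover from this have "sym_diff {j} C = D"
      by auto
    ultimately show "blade_sign {j} (sym_diff {j} C) * coords (grade_proj l (a j)) (sym_diff {j} C) =
        (if card C = Suc l then w j else 0)"
      by (simp add: w_def)
  qed
  moreover have "(\<Sum>j\<in>- C. blade_sign {j} (sym_diff {j} C) * coords (grade_proj l (a j)) (sym_diff {j} C)) =
      (\<Sum>j\<in>- C. if Suc (card C) = l then w j else 0)"
  proof (rule sum.cong [OF refl])
    fix j assume "j \<in> - C"
    moreover from this have "sym_diff {j} C = insert j C"
      by auto
    ultimately show "blade_sign {j} (sym_diff {j} C) * coords (grade_proj l (a j)) (sym_diff {j} C) =
        (if Suc (card C) = l then w j else 0)"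
      by (simp add: w_def)
  qed
  ultimately show "coords (\<Sum>j\<in>UNIV. e_gen j * grade_proj l (a j)) C = coords 0 C"
    using zero unfolding coords_sum_e_gen_mult(1)
    by (cases "card C = Suc l"; cases "Suc (card C) = l"; simp)
qed

text \<open>At \<open>C = UNIV\<close> the sum over the complement is empty, and in even dimension
  the sum over \<open>C\<close> enters the two equations with opposite signs; adding them isolates
  the time derivative.\<close>

lemma coords_pseudoscalar_dir_deriv_eq_zero:
  fixes f :: "real \<times> (real ^ 'm::{finite,linorder}) \<Rightarrow> 'm clifford"
  assumes "polynomial_function f" "two_sided_monogenic_on f UNIV" "even CARD('m)"
  shows "coords (dir_deriv (1, 0) f p) UNIV = 0"
proof -
  have "cauchy_riemann_left f p = 0" "cauchy_riemann_right f p = 0"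
    using assms(2) unfolding two_sided_monogenic_on_UNIV_iff [OF assms(1)] by blast+
  then have "coords (cauchy_riemann_left f p) UNIV = 0" "coords (cauchy_riemann_right f p) UNIV = 0"
    by simp_all
  then show ?thesis
    using assms(3) by (simp add: cauchy_riemann_left_def cauchy_riemann_right_def coords_sum_e_gen_mult)
qed

text \<open>For \<open>i > 0\<close> the factor is \<open>i\<close> or strictly negative. At
  \<open>i = 0\<close> the bound \<mu> \<le> |2 l - m| \<le> m forces \<open>k = 0\<close> and
  \<open>l\<close> to be 0 or \<open>m\<close>; as \<mu> is \<open>- m\<close> at
  \<open>l = 0\<close> and \<open>(- 1) ^ m * m\<close> at \<open>l = m\<close>, only
  \<open>l = m\<close> even remains.\<close>

lemma axial_factor_Suc_eq_zero:
  assumes "axial_factor m k l (Suc i) = 0" "l \<le> m" "m > 0"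
  shows "i = 0 \<and> k = 0 \<and> l = m \<and> even m"
proof -
  have i: "i = 0"
  proof (rule ccontr)
    assume "i \<noteq> 0"
    with assms show False
      by (cases "even i") (auto simp: axial_factor_def)
  qed
  with assms have mu: "mu m l = real m + 2 * real k"
    by (simp add: axial_factor_def)
  moreover have "mu m l \<le> \<bar>2 * real l - real m\<bar>"
    unfolding mu_def by (cases "even l") simp_all
  ultimately have "l = 0 \<or> l = m" "k = 0"
    using assms(2) by linarith+
  with i mu assms(3) show ?thesis
    by (cases "even l") (auto simp: mu_def)
qed

text \<open>Without dependence on time both Cauchy-Riemann equations become Dirac equations. Having
  both permits the split by grade, so each grade component of \<open>h\<close> at time 0 is an
  admissible \<open>P\<close>.\<close>

lemma time_independent_decomposition:
  fixes h :: "real \<times> (real ^ 'm::{finite,linorder}) \<Rightarrow> 'm clifford"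
  assumes h: "homogeneous_polynomial d h" "two_sided_monogenic_on h UNIV"
    and time: "\<And>p. dir_deriv (1, 0) h p = 0"
  shows "\<exists>P. (\<forall>l. P l \<in> left_monogenic_polys d \<and> range (P l) \<subseteq> multivectors l) \<and>
    (\<forall>p. h p = (\<Sum>l\<le>CARD('m). P l (snd p)))"
proof (intro exI conjI allI)
  have poly: "polynomial_function h" and hom: "h (t *\<^sub>R p) = t ^ d *\<^sub>R h p" for t p
    using h(1) unfolding homogeneous_polynomial_def by blast+
  define P where "P l x = grade_proj l (h (0, x))" for l x
  have bl: "bounded_linear (grade_proj l :: 'm clifford \<Rightarrow> 'm clifford)" for l
    using linear_grade_proj by (simp add: linear_conv_bounded_linear)
  show "range (P l) \<subseteq> multivectors l" for l
    by (auto simp: P_def multivectors_iff)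
  show "h p = (\<Sum>l\<le>CARD('m). P l (snd p))" for p
  proof -
    have "((\<lambda>t. h (t, snd p)) has_derivative (\<lambda>_. 0)) (at t within UNIV)" for t
      using polynomial_slice_derivs(1) [OF poly, of "snd p" t]
      by (simp add: time has_vector_derivative_def)
    then obtain c where "\<And>t. h (t, snd p) = c"
      using has_derivative_zero_constant [of UNIV "\<lambda>t. h (t, snd p)"] by auto
    then have "h p = h (0, snd p)"
      by (metis prod.collapse)
    then show ?thesis
      by (simp add: P_def sum_grade_proj)
  qed
  fix l
  have poly_P: "polynomial_function (P l)"
    unfolding P_def [abs_def]
  proof (rule polynomial_function_bounded_linear_compose [OF bl])
    have "bounded_linear (\<lambda>x :: real ^ 'm::{finite,linorder}. (0 :: real, x))"
      by (intro bounded_linear_Pair bounded_linear_zero bounded_linear_ident)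
    from polynomial_function_compose [OF polynomial_function_bounded_linear [OF this] poly]
    show "polynomial_function (\<lambda>x. h (0, x))"
      by (simp add: o_def)
  qed
  have hom_P: "P l (t *\<^sub>R x) = t ^ d *\<^sub>R P l x" for t x
    using hom [of t "(0, x)"] by (simp add: P_def linear_scale [OF linear_grade_proj])
  have "dirac_left (P l) x = 0" for x
  proof -
    have "cauchy_riemann_left h (0, x) = 0" "cauchy_riemann_right h (0, x) = 0"
      using h(2) by (simp_all add: two_sided_monogenic_on_UNIV_iff poly)
    then have "(\<Sum>j\<in>UNIV. e_gen j * grade_proj l (dir_deriv (0, axis j 1) h (0, x))) = 0"
      by (intro sum_e_gen_mult_grade_proj_eq_zero)
        (simp_all add: cauchy_riemann_left_def cauchy_riemann_right_def time)
    moreover have "(P l has_derivative (\<lambda>v. grade_proj l (dir_deriv (0, v) h (0, x)))) (at x)"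
      unfolding P_def [abs_def]
      by (rule bounded_linear.has_derivative [OF bl polynomial_slice_derivs(2) [OF poly]])
    ultimately show ?thesis
      by (simp add: dirac_left_eqI)
  qed
  then show "P l \<in> left_monogenic_polys d"
    using poly_P hom_P by (simp add: left_monogenic_polys_def homogeneous_polynomial_def)
qed

section \<open>Decomposition by induction on the degree\<close>

lemma left_monogenic_polys_scaleR:
  "P \<in> left_monogenic_polys k \<Longrightarrow> (\<lambda>x. c *\<^sub>R P x) \<in> left_monogenic_polys k"
  by (auto simp: left_monogenic_polys_def homogeneous_polynomial_def dirac_scaleR
      polynomial_function_cmul)

lemma range_multivectors_scaleR:
  "range P \<subseteq> multivectors l \<Longrightarrow> range (\<lambda>x. c *\<^sub>R P x) \<subseteq> multivectors l"
  by (auto simp: multivectors_iff)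

text \<open>The index is the pair of \<open>k\<close> and \<open>l\<close>, and the chain index
  \<open>d - k\<close> gives every summand degree \<open>d\<close>. The zero polynomial is an
  admissible \<open>P\<close>, so the whole rectangle of pairs can serve as index set.\<close>

lemma axial_decomposition:
  fixes f :: "real \<times> (real ^ 'm::{finite,linorder}) \<Rightarrow> 'm clifford"
  assumes "homogeneous_polynomial d f" "two_sided_monogenic_on f UNIV"
  shows "\<exists>P. (\<forall>i\<in>{..d} \<times> {..CARD('m)}. P i \<in> left_monogenic_polys (fst i) \<and>
      range (P i) \<subseteq> multivectors (snd i)) \<and>
    (\<forall>p. f p = (\<Sum>i\<in>{..d} \<times> {..CARD('m)}. CK_axial (fst i) (snd i) (P i) (d - fst i) p))"
  using assms
proof (induction d arbitrary: f)
  case (0 f)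
  define c where "c = f 0"
  have f: "f = (\<lambda>p. c)"
  proof
    fix p
    \<comment> \<open>Since \<open>0 ^ 0 = 1\<close>, homogeneity of degree 0 means
      constancy.\<close>
    have "f (0 *\<^sub>R p) = 0 ^ 0 *\<^sub>R f p"
      using 0(1) unfolding homogeneous_polynomial_def by blast
    then show "f p = c"
      by (simp add: c_def)
  qed
  have "dir_deriv (1, 0) f p = 0" for p
    unfolding f by (rule dir_deriv_eqI [OF has_derivative_const])
  from time_independent_decomposition [OF 0 this] obtain P where
    P: "\<And>l. P l \<in> left_monogenic_polys 0" "\<And>l. range (P l) \<subseteq> multivectors l"
      "\<And>p. f p = (\<Sum>l\<le>CARD('m). P l (snd p))"
    by blast
  have "f p = (\<Sum>i\<in>{..0} \<times> {..CARD('m)}. CK_axial (fst i) (snd i) (P (snd i)) (0 - fst i) p)" for p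
    by (simp add: P(3) sum.cartesian_product' CK_axial_zero [OF P(1,2)] case_prod_unfold)
  with P show ?case
    by (intro exI [of _ "\<lambda>i. P (snd i)"]) auto
next
  case (Suc d f)
  let ?T = "{..d} \<times> {..CARD('m)}"
  have poly: "polynomial_function f"
    using Suc.prems by (simp add: homogeneous_polynomial_def)
  obtain P where P: "\<And>i. i \<in> ?T \<Longrightarrow> P i \<in> left_monogenic_polys (fst i)"
      "\<And>i. i \<in> ?T \<Longrightarrow> range (P i) \<subseteq> multivectors (snd i)"
    and f': "\<And>p. dir_deriv (1, 0) f p =
      (\<Sum>i\<in>?T. CK_axial (fst i) (snd i) (P i) (d - fst i) p)"
    using Suc.IH [OF homogeneous_polynomial_dir_deriv [OF Suc.prems(1)]
        two_sided_monogenic_dir_deriv [OF poly Suc.prems(2)], of "(1, 0)"] by blast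
  define c where "c i = axial_factor CARD('m) (fst i) (snd i) (Suc (d - fst i))" for i
  \<comment> \<open>Time differentiation of the next chain member multiplies by
    \<open>- c i\<close>, hence this normalization. If \<open>c i = 0\<close>, division by zero
    gives \<open>Q i = 0\<close>, which is correct because \<open>P i\<close> vanishes in that
    case.\<close>
  define Q where "Q i = (\<lambda>x. (- 1 / c i) *\<^sub>R P i x)" for i
  have Q: "Q i \<in> left_monogenic_polys (fst i)" "range (Q i) \<subseteq> multivectors (snd i)" if "i \<in> ?T" for i
    unfolding Q_def
    by (rule left_monogenic_polys_scaleR [OF P(1) [OF that]],
        rule range_multivectors_scaleR [OF P(2) [OF that]])
  \<comment> \<open>A zero factor can only belong to the pseudoscalar summand of a time derivative
    of degree 0 in even dimension.\<close>
  have degenerate: "P i = (\<lambda>x. 0)" if "i \<in> ?T" "c i = 0" for i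
  proof -
    have "d - fst i = 0 \<and> fst i = 0 \<and> snd i = CARD('m) \<and> even CARD('m)"
      using that unfolding c_def by (intro axial_factor_Suc_eq_zero) auto
    then have d: "d = 0" and i: "i = (0, CARD('m))" and m: "even CARD('m)"
      by (auto simp: prod_eq_iff)
    have "dir_deriv (1, 0) f 0 = (\<Sum>l\<le>CARD('m). P (0, l) 0)"
    proof -
      have "CK_axial 0 l (P (0, l)) 0 0 = P (0, l) 0" if "l \<le> CARD('m)" for l
        using CK_axial_zero [of "P (0, l)" 0 l] P [of "(0, l)"] that by (simp add: zero_prod_def)
      then show ?thesis
        by (simp add: f' d sum.cartesian_product' case_prod_unfold)
    qed
    then have "(\<Sum>l\<le>CARD('m). coords (P (0, l) 0) UNIV) = 0"
      using coords_pseudoscalar_dir_deriv_eq_zero [OF poly Suc.prems(2) m, of 0] by (simp add: coords_sum)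
    moreover have "coords (P (0, l) 0) UNIV = 0" if "l < CARD('m)" for l
    proof -
      have "P (0, l) 0 \<in> multivectors l"
        using P(2) [of "(0, l)"] that by auto
      then show ?thesis
        using that by (simp add: multivectors_iff)
    qed
    \<comment> \<open>Lower grades have no pseudoscalar coordinate, so the vanishing sum reduces to
      its last term.\<close>
    ultimately have "coords (P i 0) UNIV = 0"
      by (simp add: lessThan_Suc_atMost [symmetric] i)
    moreover have "coords (P i 0) A = 0" if "A \<noteq> UNIV" for A
    proof -
      have "P i 0 \<in> multivectors CARD('m)"
        using P(2) [OF \<open>i \<in> ?T\<close>] by (auto simp: i)
      moreover have "card A \<noteq> CARD('m)"
        using that card_eq_UNIV_imp_eq_UNIV [of A] by auto
      ultimately show ?thesis
        by (simp add: multivectors_iff)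
    qed
    ultimately have "P i 0 = 0"
      by (metis clifford_eq_iff coords_simps(1))
    \<comment> \<open>\<open>P i\<close> has degree 0 and is therefore constant, so its value at 0
      decides.\<close>
    moreover have "P i (0 *\<^sub>R x) = 0 ^ 0 *\<^sub>R P i x" for x
      using P(1) [OF \<open>i \<in> ?T\<close>] unfolding left_monogenic_polys_def homogeneous_polynomial_def
      by (simp only: mem_Collect_eq i fst_conv)
    ultimately show ?thesis
      by (simp add: fun_eq_iff)
  qed
  \<comment> \<open>An antiderivative in time of the time derivative of \<open>f\<close>, assembled
    from the next members of the chains.\<close>
  define G where "G = (\<lambda>p. \<Sum>i\<in>?T. CK_axial (fst i) (snd i) (Q i) (Suc (d - fst i)) p)"
  have G: "homogeneous_polynomial (Suc d) G" "two_sided_monogenic_on G UNIV"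
  proof -
    have "homogeneous_polynomial (Suc d) (CK_axial (fst i) (snd i) (Q i) (Suc (d - fst i)))" if "i \<in> ?T" for i
      using homogeneous_CK_axial [OF Q [OF that], of "Suc (d - fst i)"] that by auto
    then show "homogeneous_polynomial (Suc d) G"
      unfolding G_def by (intro homogeneous_polynomial_sum) auto
    show "two_sided_monogenic_on G UNIV"
      unfolding G_def
      by (intro two_sided_monogenic_sum polynomial_CK_axial two_sided_monogenic_CK_axial Q) simp_all
  qed
  have dG: "dir_deriv (1, 0) G p = dir_deriv (1, 0) f p" for p
  proof -
    have "dir_deriv (1, 0) G p =
        (\<Sum>i\<in>?T. dir_deriv (1, 0) (CK_axial (fst i) (snd i) (Q i) (Suc (d - fst i))) p)"
      unfolding G_def
      by (rule dir_deriv_eqI) (intro has_derivative_sum has_derivative_dir_deriv polynomial_CK_axial Q)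
    also have "\<dots> = (\<Sum>i\<in>?T. CK_axial (fst i) (snd i) (P i) (d - fst i) p)"
    proof (rule sum.cong [OF refl])
      fix i assume i: "i \<in> ?T"
      have "dir_deriv (1, 0) (CK_axial (fst i) (snd i) (Q i) (Suc (d - fst i))) p =
          (- c i * (- 1 / c i)) *\<^sub>R CK_axial (fst i) (snd i) (P i) (d - fst i) p"
        unfolding dir_deriv_CK_axial [OF Q [OF i]] unfolding Q_def CK_axial_scaleR [OF P [OF i]] c_def
        by simp
      \<comment> \<open>In the case \<open>c i = 0\<close> both sides are 0: scaling by 0 evaluates
        the extension of the zero function.\<close>
      also have "\<dots> = CK_axial (fst i) (snd i) (P i) (d - fst i) p"
        using CK_axial_scaleR [OF P [OF i], of 0 "d - fst i" p] degenerate [OF i]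
        by (cases "c i = 0") simp_all
      finally show "dir_deriv (1, 0) (CK_axial (fst i) (snd i) (Q i) (Suc (d - fst i))) p =
          CK_axial (fst i) (snd i) (P i) (d - fst i) p" .
    qed
    finally show ?thesis
      by (simp add: f')
  qed
  define h where "h = (\<lambda>p. f p - G p)"
  have poly_G: "polynomial_function G"
    using G(1) by (simp add: homogeneous_polynomial_def)
  have h: "homogeneous_polynomial (Suc d) h" "two_sided_monogenic_on h UNIV"
    unfolding h_def by (intro homogeneous_polynomial_diff two_sided_monogenic_diff poly poly_G Suc.prems G)+
  have "dir_deriv (1, 0) h p = 0" for p
  proof -
    have "dir_deriv (1, 0) h p = dir_deriv (1, 0) f p - dir_deriv (1, 0) G p"
      unfolding h_def by (rule dir_deriv_eqI) (intro has_derivative_diff has_derivative_dir_deriv poly poly_G)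
    then show ?thesis
      by (simp add: dG)
  qed
  from time_independent_decomposition [OF h this] obtain R where R: "\<And>l. R l \<in> left_monogenic_polys (Suc d)"
      "\<And>l. range (R l) \<subseteq> multivectors l" "\<And>p. h p = (\<Sum>l\<le>CARD('m). R l (snd p))"
    by blast
  \<comment> \<open>Pairs with \<open>k \<le> d\<close> keep their chain with the index raised by
    one; the new pairs with \<open>k = d + 1\<close> have chain index 0 and account for the
    remainder \<open>h\<close>.\<close>
  define S where "S i = (if fst i \<le> d then Q i else R (snd i))" for i
  have T: "{..Suc d} \<times> {..CARD('m)} = ?T \<union> {Suc d} \<times> {..CARD('m)}" "?T \<inter> {Suc d} \<times> {..CARD('m)} = {}"
    by (auto simp: le_Suc_eq)
  have "f p = (\<Sum>i\<in>{..Suc d} \<times> {..CARD('m)}. CK_axial (fst i) (snd i) (S i) (Suc d - fst i) p)" for p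
  proof -
    have "(\<Sum>i\<in>{..Suc d} \<times> {..CARD('m)}. CK_axial (fst i) (snd i) (S i) (Suc d - fst i) p) =
        (\<Sum>i\<in>?T. CK_axial (fst i) (snd i) (S i) (Suc d - fst i) p) +
        (\<Sum>i\<in>{Suc d} \<times> {..CARD('m)}. CK_axial (fst i) (snd i) (S i) (Suc d - fst i) p)"
      unfolding T(1) by (rule sum.union_disjoint) (use T(2) in auto)
    also have "(\<Sum>i\<in>?T. CK_axial (fst i) (snd i) (S i) (Suc d - fst i) p) = G p"
      unfolding G_def by (rule sum.cong) (auto simp: S_def Suc_diff_le)
    also have "(\<Sum>i\<in>{Suc d} \<times> {..CARD('m)}. CK_axial (fst i) (snd i) (S i) (Suc d - fst i) p) = h p"
      by (simp add: R(3) S_def sum.cartesian_product' CK_axial_zero [OF R(1,2)] case_prod_unfold)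
    finally show ?thesis
      by (simp add: h_def)
  qed
  moreover have "S i \<in> left_monogenic_polys (fst i) \<and> range (S i) \<subseteq> multivectors (snd i)"
    if "i \<in> {..Suc d} \<times> {..CARD('m)}" for i
  proof (cases "fst i \<le> d")
    case True
    with that have "i \<in> ?T"
      by auto
    with True Q show ?thesis
      by (simp only: S_def if_True)
  next
    case False
    with that have "fst i = Suc d"
      by auto
    with False R(1,2) show ?thesis
      by (simp only: S_def if_False)
  qed
  ultimately show ?case
    by blast
qed

theorem corollary1:
  fixes f :: "real \<times> (real ^ 'm::{finite,linorder}) \<Rightarrow> 'm clifford"
  assumes "homogeneous_polynomial d f"
    and "two_sided_monogenic_on f UNIV"
  shows "\<exists>(N::nat) (F :: nat \<Rightarrow> real \<times> (real ^ 'm::{finite,linorder}) \<Rightarrow> 'm clifford).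
    f = (\<lambda>p. \<Sum>i<N. F i p) \<and>
    (\<forall>i<N.
      polynomial_function (F i) \<and>
      two_sided_monogenic_on (F i) UNIV \<and>
      axial_two_sided_monogenic_on (F i) {(x1, x2). x2 > 0} \<and>
      (\<exists>k l P. l \<le> CARD('m) \<and> P \<in> left_monogenic_polys k \<and> range P \<subseteq> multivectors l \<and>
        ((\<exists>n\<ge>1. F i = CK (\<lambda>x. alpha CARD('m) k n l *\<^sub>R norm x ^ (2 * n) *\<^sub>R P x
              + norm x ^ (2 * n - 2) *\<^sub>R (cvec x * P x * cvec x))) \<or>
         F i = (\<lambda>(x0, x). P x) \<or>
         (\<exists>n. F i = CK (\<lambda>x. norm x ^ (2 * n) *\<^sub>R (cvec x * P x + P x * cvec x))))))"
proof -
  let ?T = "{..d} \<times> {..CARD('m)}"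
  obtain P where P: "\<And>i. i \<in> ?T \<Longrightarrow> P i \<in> left_monogenic_polys (fst i)"
      "\<And>i. i \<in> ?T \<Longrightarrow> range (P i) \<subseteq> multivectors (snd i)"
    and f: "\<And>p. f p = (\<Sum>i\<in>?T. CK_axial (fst i) (snd i) (P i) (d - fst i) p)"
    using axial_decomposition [OF assms] by blast
  \<comment> \<open>An enumeration of the index pairs turns the sum over the rectangle into a sum
    over an initial segment of the naturals.\<close>
  obtain e where e: "bij_betw e {0..<card ?T} ?T"
    using ex_bij_betw_nat_finite [of ?T] by blast
  define F where "F i = CK_axial (fst (e i)) (snd (e i)) (P (e i)) (d - fst (e i))" for i
  have sum_F: "f = (\<lambda>p. \<Sum>i<card ?T. F i p)"
  proof
    fix p
    show "f p = (\<Sum>i<card ?T. F i p)"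
      unfolding f F_def
      using sum.reindex_bij_betw [OF e, of "\<lambda>i. CK_axial (fst i) (snd i) (P i) (d - fst i) p"]
      by (simp only: atLeast0LessThan)
  qed
  have "polynomial_function (F i) \<and>
      two_sided_monogenic_on (F i) UNIV \<and>
      axial_two_sided_monogenic_on (F i) {(x1, x2). x2 > 0} \<and>
      (\<exists>k l P. l \<le> CARD('m) \<and> P \<in> left_monogenic_polys k \<and> range P \<subseteq> multivectors l \<and>
        ((\<exists>n\<ge>1. F i = CK (\<lambda>x. alpha CARD('m) k n l *\<^sub>R norm x ^ (2 * n) *\<^sub>R P x
              + norm x ^ (2 * n - 2) *\<^sub>R (cvec x * P x * cvec x))) \<or>
         F i = (\<lambda>(x0, x). P x) \<or>
         (\<exists>n. F i = CK (\<lambda>x. norm x ^ (2 * n) *\<^sub>R (cvec x * P x + P x * cvec x)))))"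
    if "i < card ?T" for i
  proof -
    obtain k l where kl: "e i = (k, l)"
      by (cases "e i")
    define p where "p = P (e i)"
    have "e i \<in> ?T"
      using bij_betwE [OF e] that by (simp only: Ball_def atLeastLessThan_iff) blast
    then have l: "l \<le> CARD('m)" and p: "p \<in> left_monogenic_polys k" "range p \<subseteq> multivectors l"
      using P [of "e i"] by (simp_all add: p_def kl)
    have F: "F i = CK_axial k l p (d - k)"
      by (simp add: F_def kl p_def)
    \<comment> \<open>The chain index decides the family: 0 gives \<open>P\<close>, positive even
      values the first family, odd values the third.\<close>
    consider "d - k = 0" | n where "d - k = 2 * n" "n \<ge> 1" | n where "d - k = 2 * n + 1"
    proof (cases "even (d - k)")
      case True
      then obtain n where "d - k = 2 * n"
        by (elim evenE)
      with that(1) that(2) [of n] show ?thesis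
        by (cases "n = 0") simp_all
    next
      case False
      then show ?thesis
        using that(3) by (elim oddE)
    qed
    then have "(\<exists>n\<ge>1. F i = CK (\<lambda>x. alpha CARD('m) k n l *\<^sub>R norm x ^ (2 * n) *\<^sub>R p x
              + norm x ^ (2 * n - 2) *\<^sub>R (cvec x * p x * cvec x))) \<or>
         F i = (\<lambda>(x0, x). p x) \<or>
         (\<exists>n. F i = CK (\<lambda>x. norm x ^ (2 * n) *\<^sub>R (cvec x * p x + p x * cvec x)))"
    proof cases
      case 1
      then show ?thesis
        by (simp add: F CK_axial_zero [OF p])
    next
      case (2 n)
      then have "F i = CK (\<lambda>x. alpha CARD('m) k n l *\<^sub>R norm x ^ (2 * n) *\<^sub>R p x
              + norm x ^ (2 * n - 2) *\<^sub>R (cvec x * p x * cvec x))"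
        unfolding F CK_axial_def axial_initial_def [abs_def] by simp
      with 2 show ?thesis
        by blast
    next
      case (3 n)
      then have "F i = CK (\<lambda>x. norm x ^ (2 * n) *\<^sub>R (cvec x * p x + p x * cvec x))"
        unfolding F CK_axial_def axial_initial_def [abs_def] by simp
      then show ?thesis
        by blast
    qed
    with l p have "\<exists>k l P. l \<le> CARD('m) \<and> P \<in> left_monogenic_polys k \<and> range P \<subseteq> multivectors l \<and>
        ((\<exists>n\<ge>1. F i = CK (\<lambda>x. alpha CARD('m) k n l *\<^sub>R norm x ^ (2 * n) *\<^sub>R P x
              + norm x ^ (2 * n - 2) *\<^sub>R (cvec x * P x * cvec x))) \<or>
         F i = (\<lambda>(x0, x). P x) \<or>
         (\<exists>n. F i = CK (\<lambda>x. norm x ^ (2 * n) *\<^sub>R (cvec x * P x + P x * cvec x))))"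
      by (intro exI [of _ k] exI [of _ l] exI [of _ p] conjI)
    then show ?thesis
      using polynomial_CK_axial [OF p] two_sided_monogenic_CK_axial [OF p]
        axial_two_sided_monogenic_CK_axial [OF p l] unfolding F by (intro conjI)
  qed
  then show ?thesis
    by (intro exI [of _ "card ?T"], intro exI [of _ F], intro conjI [OF sum_F])
      (intro allI impI)
qed

end
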